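(* For every connected constraint graph $H$ with at least one edge and every activity vector $\lambda$ on $H$, there is exactly one simple, invariant Gibbs measure for $\lambda$ on $\hom(\mathbb{T}^1,H)$.
   Context: A constraint graph $H$ is a finite graph with node set $\{1,\dots,q\}$, possibly with loops but no multiple edges. $\mathbb{T}^1$ is the doubly infinite path (sites $\mathbb{Z}$, $n\sim n+1$). $\hom(G,H)$ is the set of graph homomorphisms from the board $G$ to $H$, with the product $\sigma$-algebra. An activity vector is $\lambda=(\lambda_1,\dots,\lambda_q)$ with all $\lambda_i>0$; for finite $G$ the $\lambda$-measure on $\hom(G,H)$ gives $\varphi$ probability proportional to $\prod_v\lambda_{\varphi(v)}$. A patch is a finite set $U$ of sites, $\partial U$ the set of sites outside $U$ adjacent to $U$, $U^+=U\cup\partial U$. A probability measure $\mu$ on $\hom(G,H)$ is a Gibbs measure for $\lambda$ if for every patch $U$ and $\mu$-a.e. $\psi$, the $\mu$-conditional probability that $\varphi|_U=\psi|_U$ given $\varphi|_{G\setminus U}=\psi|_{G\setminus U}$ equals the $\lambda$-measure (on $\hom(U^+,H)$) conditional probability that $\varphi|_U=\psi|_U$ given $\varphi|_{\partial U}=\psi|_{\partial U}$. A Gibbs measure on $\hom(T,H)$, $T$ a tree, is simple if for every site $u$ and node $i$, the restrictions of $\varphi$ to the components of $T\setminus\{u\}$ are mutually independent given $\varphi(u)=i$; a measure is invariant if it is preserved by every automorphism of the board acting by precomposition. *)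

theory Defs
  imports "HOL-Probability.Probability"
begin

definition constraint_graph :: "nat \<Rightarrow> (nat \<Rightarrow> nat \<Rightarrow> bool) \<Rightarrow> bool" where
  "constraint_graph q E \<longleftrightarrow>
     (\<forall>i j. E i j \<longrightarrow> i \<in> {1..q} \<and> j \<in> {1..q}) \<and> (\<forall>i j. E i j \<longrightarrow> E j i)"

definition graph_connected :: "nat \<Rightarrow> (nat \<Rightarrow> nat \<Rightarrow> bool) \<Rightarrow> bool" where
  "graph_connected q E \<longleftrightarrow> (\<forall>i\<in>{1..q}. \<forall>j\<in>{1..q}. E\<^sup>*\<^sup>* i j)"

definition has_edge :: "(nat \<Rightarrow> nat \<Rightarrow> bool) \<Rightarrow> bool" where
  "has_edge E \<longleftrightarrow> (\<exists>i j. E i j)"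

definition activity :: "nat \<Rightarrow> (nat \<Rightarrow> real) \<Rightarrow> bool" where
  "activity q lam \<longleftrightarrow> (\<forall>i\<in>{1..q}. lam i > 0)"

section \<open>The board T^1: sites Z, n ~ n+1\<close>

definition adjZ :: "int \<Rightarrow> int \<Rightarrow> bool" where
  "adjZ m n \<longleftrightarrow> \<bar>m - n\<bar> = 1"

definition bdry :: "int set \<Rightarrow> int set" where
  "bdry U = {v. v \<notin> U \<and> (\<exists>u\<in>U. adjZ v u)}"

definition closure_plus :: "int set \<Rightarrow> int set" where
  "closure_plus U = U \<union> bdry U"

definition board_aut :: "(int \<Rightarrow> int) \<Rightarrow> bool" where
  "board_aut \<alpha> \<longleftrightarrow> bij \<alpha> \<and> (\<forall>m n. adjZ m n \<longleftrightarrow> adjZ (\<alpha> m) (\<alpha> n))"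

definition Hom :: "nat \<Rightarrow> (nat \<Rightarrow> nat \<Rightarrow> bool) \<Rightarrow> (int \<Rightarrow> nat) set" where
  "Hom q E = {\<phi>. (\<forall>n. \<phi> n \<in> {1..q}) \<and> (\<forall>m n. adjZ m n \<longrightarrow> E (\<phi> m) (\<phi> n))}"

definition HomM :: "nat \<Rightarrow> (nat \<Rightarrow> nat \<Rightarrow> bool) \<Rightarrow> (int \<Rightarrow> nat) measure" where
  "HomM q E = restrict_space (PiM UNIV (\<lambda>_::int. count_space {1..q})) (Hom q E)"

definition sigma_on :: "nat \<Rightarrow> (nat \<Rightarrow> nat \<Rightarrow> bool) \<Rightarrow> int set \<Rightarrow> (int \<Rightarrow> nat) measure" where
  "sigma_on q E S = vimage_algebra (space (HomM q E)) (\<lambda>\<phi>. restrict \<phi> S)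
                       (PiM S (\<lambda>_. count_space {1..q}))"

definition HomFin :: "nat \<Rightarrow> (nat \<Rightarrow> nat \<Rightarrow> bool) \<Rightarrow> int set \<Rightarrow> (int \<Rightarrow> nat) set" where
  "HomFin q E B = {\<phi> \<in> PiE B (\<lambda>_. {1..q}). \<forall>m\<in>B. \<forall>n\<in>B. adjZ m n \<longrightarrow> E (\<phi> m) (\<phi> n)}"

definition weight :: "(nat \<Rightarrow> real) \<Rightarrow> int set \<Rightarrow> (int \<Rightarrow> nat) \<Rightarrow> real" where
  "weight lam B \<phi> = (\<Prod>v\<in>B. lam (\<phi> v))"

definition lam_prob :: "nat \<Rightarrow> (nat \<Rightarrow> nat \<Rightarrow> bool) \<Rightarrow> (nat \<Rightarrow> real) \<Rightarrow> int set
                        \<Rightarrow> (int \<Rightarrow> nat) set \<Rightarrow> real" where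
  "lam_prob q E lam B A =
     (\<Sum>\<phi>\<in>A \<inter> HomFin q E B. weight lam B \<phi>) / (\<Sum>\<phi>\<in>HomFin q E B. weight lam B \<phi>)"

definition lam_cond :: "nat \<Rightarrow> (nat \<Rightarrow> nat \<Rightarrow> bool) \<Rightarrow> (nat \<Rightarrow> real) \<Rightarrow> int set
                        \<Rightarrow> (int \<Rightarrow> nat) \<Rightarrow> real" where
  "lam_cond q E lam U \<psi> =
     (let B = closure_plus U;
          EvU = {\<phi>. \<forall>v\<in>U. \<phi> v = \<psi> v};
          EvD = {\<phi>. \<forall>v\<in>bdry U. \<phi> v = \<psi> v}
      in lam_prob q E lam B (EvU \<inter> EvD) / lam_prob q E lam B EvD)"

definition measure_on_Hom :: "nat \<Rightarrow> (nat \<Rightarrow> nat \<Rightarrow> bool) \<Rightarrow> (int \<Rightarrow> nat) measure \<Rightarrow> bool" where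
  "measure_on_Hom q E \<mu> \<longleftrightarrow> prob_space \<mu> \<and> sets \<mu> = sets (HomM q E)"

definition gibbs :: "nat \<Rightarrow> (nat \<Rightarrow> nat \<Rightarrow> bool) \<Rightarrow> (nat \<Rightarrow> real) \<Rightarrow> (int \<Rightarrow> nat) measure \<Rightarrow> bool" where
  "gibbs q E lam \<mu> \<longleftrightarrow> measure_on_Hom q E \<mu> \<and>
     (\<forall>U. finite U \<longrightarrow>
        (AE \<psi> in \<mu>.
           real_cond_exp \<mu> (sigma_on q E (- U))
             (indicator {\<phi> \<in> space \<mu>. \<forall>v\<in>U. \<phi> v = \<psi> v}) \<psi>
           = lam_cond q E lam U \<psi>))"

text \<open>Simple: given phi(u) = i, the restrictions of phi to the two components
  {..<u} and {u<..} of T^1 minus u are independent (conditioning on events of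
  positive probability).\<close>
definition simple :: "nat \<Rightarrow> (nat \<Rightarrow> nat \<Rightarrow> bool) \<Rightarrow> (int \<Rightarrow> nat) measure \<Rightarrow> bool" where
  "simple q E \<mu> \<longleftrightarrow>
     (\<forall>u i. let C = {\<phi> \<in> space \<mu>. \<phi> u = i} in
        emeasure \<mu> C > 0 \<longrightarrow>
        prob_space.indep_var (uniform_measure \<mu> C)
          (PiM {..<u} (\<lambda>_. count_space {1..q})) (\<lambda>\<phi>. restrict \<phi> {..<u})
          (PiM {u<..} (\<lambda>_. count_space {1..q})) (\<lambda>\<phi>. restrict \<phi> {u<..}))"

definition invariant :: "nat \<Rightarrow> (nat \<Rightarrow> nat \<Rightarrow> bool) \<Rightarrow> (int \<Rightarrow> nat) measure \<Rightarrow> bool" where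
  "invariant q E \<mu> \<longleftrightarrow> (\<forall>\<alpha>. board_aut \<alpha> \<longrightarrow> distr \<mu> (HomM q E) (\<lambda>\<phi>. \<phi> \<circ> \<alpha>) = \<mu>)"

end

theory Submission
  imports Defs
begin

text \<open>
  Let \<open>h > 0\<close> be the Perron eigenvector of \<open>(E i j * lam j)\<close>, with eigenvalue \<open>\<rho>\<close>. The measure
  sought gives the configuration \<open>x\<close> on a window \<open>{a..b}\<close> the probability
  \<open>h (x a) * h (x b) * (\<Prod>k\<in>{a..b}. lam (x k)) / \<rho> ^ (b - a)\<close> if \<open>x\<close> is a walk in the constraint graph,
  and 0 otherwise.

  Conversely, a simple measure is a Markov chain, and by reflection invariance a reversible one:
  its edge weights \<open>m i j\<close> are symmetric. The single-site Gibbs property applied to two equal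
  neighbours \<open>i\<close> gives \<open>(m i j)\<^sup>2 = c i * lam j * \<pi> j\<close>, where \<open>\<pi>\<close> is the one-site marginal. By symmetry
  and connectedness \<open>c i\<close> is proportional to \<open>lam i * \<pi> i\<close>, so \<open>m i j\<close> is proportional to
  \<open>sqrt (lam i * \<pi> i) * sqrt (lam j * \<pi> j)\<close>; summing over \<open>j\<close> shows that
  \<open>sqrt (\<pi> i / lam i)\<close> is the positive eigenvector, which is unique.
\<close>

section \<open>The Perron eigenvector\<close>

text \<open>Equal neighbours are the decisive choice. By the Markov property the triple
  \<open>i, j, i\<close> has probability \<open>m i j * m j i / \<pi> j\<close>, which reflection
  turns into a square over \<open>\<pi> j\<close>, so one equation determines one edge weight;
  unequal neighbours would couple two unknown weights. The constant \<open>c i\<close> is the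
  probability that both neighbours equal \<open>i\<close>, divided by the sum of \<open>lam\<close>
  over the graph neighbours of \<open>i\<close>. Only uniqueness of the positive eigenvector is
  used, never convergence of matrix powers, so bipartite constraint graphs, whose chain has period
  two, need no separate treatment. The measure is built directly as a chain rather than as a limit
  of finite-volume measures: the eigenvector equation says exactly that summing out an endpoint of a
  window gives the formula for the shorter window. The factors \<open>h\<close> sit at the ends of
  the window, so they cancel when one conditions on the outside of a patch strictly inside
  it.\<close>

locale hom_model =
  fixes q :: nat and E :: "nat \<Rightarrow> nat \<Rightarrow> bool" and lam :: "nat \<Rightarrow> real"
  assumes graph: "constraint_graph q E"
    and conn: "graph_connected q E"
    and edge: "has_edge E"
    and act: "activity q lam"
begin

lemma E_dom: "E i j \<Longrightarrow> i \<in> {1..q}" "E i j \<Longrightarrow> j \<in> {1..q}"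
  using graph by (auto simp: constraint_graph_def)

lemma E_sym: "E i j \<longleftrightarrow> E j i"
  using graph by (auto simp: constraint_graph_def)

lemma lam_pos: "i \<in> {1..q} \<Longrightarrow> 0 < lam i"
  using act by (auto simp: activity_def)

text \<open>Connectedness of the constraint graph enters only here. It spreads proportionality and
  positivity in the Perron part, and later positivity of the one-site marginal and constancy of the
  ratio \<open>c i / (lam i * pt i)\<close>.\<close>

lemma connected_propagate:
  assumes "P i" "i \<in> {1..q}" "j \<in> {1..q}" and step: "\<And>k l. E k l \<Longrightarrow> P k \<Longrightarrow> P l"
  shows "P j"
proof -
  have "E\<^sup>*\<^sup>* i j" using conn assms by (auto simp: graph_connected_def)
  then show ?thesis by (induction rule: rtranclp_induct) (use assms in auto)
qed

text \<open>Requiring \<open>h\<close> to vanish off the node set makes it unique as a function on \<open>nat\<close>.\<close>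

definition perron :: "(nat \<Rightarrow> real) \<Rightarrow> real \<Rightarrow> bool" where
  "perron h \<rho> \<longleftrightarrow> 0 < \<rho> \<and> (\<forall>i\<in>{1..q}. 0 < h i) \<and> (\<forall>i. i \<notin> {1..q} \<longrightarrow> h i = 0) \<and>
     (\<forall>i\<in>{1..q}. (\<Sum>j\<in>{1..q}. of_bool (E i j) * lam j * h j) = \<rho> * h i) \<and>
     (\<Sum>i\<in>{1..q}. lam i * (h i)\<^sup>2) = 1"

text \<open>With \<open>A\<close> the matrix \<open>E i j * lam j\<close>, this is the
  \<open>nform\<close> pairing of \<open>x\<close> with \<open>A y\<close>.\<close>

definition qform :: "(nat \<Rightarrow> real) \<Rightarrow> (nat \<Rightarrow> real) \<Rightarrow> real" where
  "qform x y = (\<Sum>i\<in>{1..q}. \<Sum>j\<in>{1..q}. of_bool (E i j) * (lam i * x i) * (lam j * y j))"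

definition nform :: "(nat \<Rightarrow> real) \<Rightarrow> (nat \<Rightarrow> real) \<Rightarrow> real" where
  "nform x y = (\<Sum>i\<in>{1..q}. lam i * x i * y i)"

lemma qform_commute: "qform x y = qform y x"
  unfolding qform_def by (subst sum.swap) (auto intro!: sum.cong simp: E_sym mult_ac)

lemma nform_commute: "nform x y = nform y x"
  unfolding nform_def by (simp add: mult_ac)

text \<open>Together with its analogue for \<open>nform\<close>, this gives the variation of
  \<open>qform - \<rho> * nform\<close> around the maximiser.\<close>

lemma qform_add_scaled: "qform (\<lambda>i. x i + t * z i) (\<lambda>i. x i + t * z i) = qform x x + 2 * t * qform x z + t\<^sup>2 * qform z z"
proof -
  have "qform (\<lambda>i. x i + t * z i) (\<lambda>i. x i + t * z i) =
      qform x x + t * qform x z + t * qform z x + t\<^sup>2 * qform z z"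
    unfolding qform_def
    by (simp add: sum_distrib_left sum.distrib[symmetric] algebra_simps power2_eq_square)
  then show ?thesis using qform_commute[of z x] by simp
qed

lemma nform_add_scaled: "nform (\<lambda>i. x i + t * z i) (\<lambda>i. x i + t * z i) = nform x x + 2 * t * nform x z + t\<^sup>2 * nform z z"
proof -
  have "nform (\<lambda>i. x i + t * z i) (\<lambda>i. x i + t * z i) =
      nform x x + t * nform x z + t * nform z x + t\<^sup>2 * nform z z"
    unfolding nform_def
    by (simp add: sum_distrib_left sum.distrib[symmetric] algebra_simps power2_eq_square)
  then show ?thesis using nform_commute[of z x] by simp
qed

lemma qform_eq: "qform x y = (\<Sum>i\<in>{1..q}. lam i * x i * (\<Sum>j\<in>{1..q}. of_bool (E i j) * lam j * y j))"
  unfolding qform_def by (simp add: sum_distrib_left mult_ac)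

text \<open>Self-adjointness evaluates \<open>qform h g\<close> with either eigenvalue, and
  \<open>nform h g\<close> is positive, so the eigenvalues agree. The vectors are then compared by
  contact: the largest multiple of \<open>g\<close> below \<open>h\<close> touches \<open>h\<close>
  at some node, contact spreads along edges, and the normalisation makes the multiple 1.\<close>

lemma perron_unique:
  assumes "perron h \<rho>" "perron g \<sigma>"
  shows "h = g" "\<rho> = \<sigma>"
proof -
  note h = assms(1)[unfolded perron_def] and g = assms(2)[unfolded perron_def]
  obtain i0 where i0: "i0 \<in> {1..q}" using edge E_dom by (auto simp: has_edge_def)
  have "qform h g = \<sigma> * nform h g"
    unfolding qform_eq nform_def using g by (simp add: sum_distrib_left mult_ac)
  moreover have "qform g h = \<rho> * nform g h"
    unfolding qform_eq nform_def using h by (simp add: sum_distrib_left mult_ac)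
  moreover have "nform h g > 0"
    unfolding nform_def using h g i0 lam_pos by (intro sum_pos) auto
  ultimately show \<rho>\<sigma>: "\<rho> = \<sigma>"
    using qform_commute[of h g] nform_commute[of h g] by simp
  define t where "t = Min ((\<lambda>i. h i / g i) ` {1..q})"
  have "t \<in> (\<lambda>i. h i / g i) ` {1..q}" unfolding t_def using i0 by (intro Min_in) auto
  then obtain i where i: "i \<in> {1..q}" "t = h i / g i" by auto
  have t_le: "t * g j \<le> h j" if "j \<in> {1..q}" for j
  proof -
    have "t \<le> h j / g j" unfolding t_def using that by (intro Min_le) auto
    then show ?thesis using g that by (simp add: field_simps)
  qed
  have step: "h l = t * g l" if kl: "E k l" and k: "h k = t * g k" for k l
  proof -
    have kV: "k \<in> {1..q}" and lV: "l \<in> {1..q}" using E_dom kl by auto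
    \<comment> \<open>The eigenvector equation of \<open>h - t * g\<close> at a contact node: a sum
      of nonnegative terms vanishes, so every neighbour is a contact node.\<close>
    have "(\<Sum>j\<in>{1..q}. of_bool (E k j) * lam j * (h j - t * g j)) =
        (\<Sum>j\<in>{1..q}. of_bool (E k j) * lam j * h j) - t * (\<Sum>j\<in>{1..q}. of_bool (E k j) * lam j * g j)"
      unfolding sum_distrib_left sum_subtractf[symmetric] by (intro sum.cong) (auto simp: algebra_simps)
    also have "\<dots> = \<rho> * h k - t * (\<rho> * g k)"
      using h g kV \<rho>\<sigma> by auto
    also have "\<dots> = 0" using k by simp
    finally have "\<forall>j\<in>{1..q}. of_bool (E k j) * lam j * (h j - t * g j) = 0"
      by (subst (asm) sum_nonneg_eq_0_iff) (use t_le lam_pos in \<open>auto simp: less_imp_le\<close>)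
    with lV kl lam_pos[OF lV] show ?thesis by auto
  qed
  have "g i > 0" using g i by blast
  then have hi: "h i = t * g i" using i(2) by simp
  have ht: "h j = t * g j" if "j \<in> {1..q}" for j
    by (rule connected_propagate[where P="\<lambda>j. h j = t * g j", OF hi i(1) that]) (rule step)
  have "t\<^sup>2 * (\<Sum>i\<in>{1..q}. lam i * (g i)\<^sup>2) = (\<Sum>i\<in>{1..q}. lam i * (h i)\<^sup>2)"
    unfolding sum_distrib_left by (intro sum.cong) (auto simp: ht power_mult_distrib)
  then have "t\<^sup>2 = 1" using h g by simp
  moreover have "t > 0" using i h g by simp
  ultimately have "t = 1" by (simp add: power2_eq_1_iff)
  show "h = g"
  proof
    fix j
    show "h j = g j"
    proof (cases "j \<in> {1..q}")
      case True
      then show ?thesis using ht[OF True] \<open>t = 1\<close> by simp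
    next
      case False
      then show ?thesis using h g by presburger
    qed
  qed
qed

text \<open>The matrix is self-adjoint for \<open>nform\<close>, so a maximiser of \<open>qform\<close> on the unit sphere is an
  eigenvector; taking absolute values does not decrease \<open>qform\<close>.\<close>

lemma perron_exists: "\<exists>h \<rho>. perron h \<rho>"
proof -
  define K where "K = {x :: nat \<Rightarrow> real. (\<forall>i. i \<notin> {1..q} \<longrightarrow> x i = 0) \<and> nform x x = 1}"
  define b where "b i = sqrt (1 / lam i)" for i
  obtain i0 j0 where E0: "E i0 j0" using edge by (auto simp: has_edge_def)
  have i0: "i0 \<in> {1..q}" and j0: "j0 \<in> {1..q}" using E0 E_dom by auto
  have cont: "continuous_on S (\<lambda>x::nat\<Rightarrow>real. x i)" for S i
    by (rule continuous_on_subset[OF continuous_on_product_coordinates]) auto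
  have contq: "continuous_on S (\<lambda>x. qform x x)" for S
    unfolding qform_def by (intro continuous_intros cont)
  have contn: "continuous_on S (\<lambda>x. nform x x)" for S
    unfolding nform_def by (intro continuous_intros cont)
  \<comment> \<open>Coordinates off the node set are pinned to 0 and the others bounded by
    \<open>b\<close>, so Tychonoff gives compactness in the infinite product.\<close>
  let ?P = "PiE UNIV (\<lambda>i. if i \<in> {1..q} then {- b i .. b i} else {0})"
  have cP: "compact ?P"
    using compactin_PiE[of "\<lambda>i::nat. euclidean :: real topology" UNIV "\<lambda>i. if i \<in> {1..q} then {- b i .. b i} else {0}"]
    unfolding euclidean_product_topology by auto
  have Kb: "\<bar>x i\<bar> \<le> b i" if "x \<in> K" "i \<in> {1..q}" for x i
  proof -
    have "lam i * x i * x i \<le> nform x x"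
      unfolding nform_def
      by (rule member_le_sum[where f="\<lambda>i. lam i * x i * x i"])
         (use that lam_pos in \<open>auto simp: mult.assoc less_imp_le\<close>)
    then have "(x i)\<^sup>2 \<le> 1 / lam i"
      using that lam_pos[OF that(2)] by (simp add: K_def field_simps power2_eq_square)
    then show ?thesis unfolding b_def using real_sqrt_le_mono by fastforce
  qed
  have "K = ?P \<inter> {x. nform x x = 1}"
  proof (intro set_eqI iffI)
    fix x assume x: "x \<in> K"
    have "x i \<in> (if i \<in> {1..q} then {- b i .. b i} else {0})" for i
      using Kb[OF x, of i] x by (auto simp: K_def)
    then show "x \<in> ?P \<inter> {x. nform x x = 1}" using x by (auto simp: K_def)
  next
    fix x assume x: "x \<in> ?P \<inter> {x. nform x x = 1}"
    then have xP: "x \<in> ?P" by blast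
    have "x i \<in> (if i \<in> {1..q} then {- b i .. b i} else {0})" for i
      by (rule PiE_mem[OF xP UNIV_I])
    from this have "x i = 0" if "i \<notin> {1..q}" for i using that by (metis singletonD)
    then show "x \<in> K" using x by (auto simp: K_def)
  qed
  moreover have "closed {x. nform x x = 1}"
    by (rule closed_Collect_eq[OF contn continuous_on_const])
  ultimately have "compact K" using cP by auto
  \<comment> \<open>A constant vector on the nodes, to be scaled to norm 1. One edge makes
    \<open>qform\<close> positive there, hence the maximum \<open>\<rho>\<close> is
    positive.\<close>
  define y0 where "y0 c k = (if k \<in> {1..q} then c else 0)" for c :: real and k :: nat
  have "sum lam {1..q} > 0" using i0 lam_pos by (intro sum_pos) auto
  moreover have "nform (y0 c) (y0 c) = c\<^sup>2 * sum lam {1..q}" for c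
    unfolding nform_def y0_def sum_distrib_left by (intro sum.cong) (auto simp: power2_eq_square)
  ultimately obtain c where c: "c > 0" "nform (y0 c) (y0 c) = 1"
    by (intro that[of "1 / sqrt (sum lam {1..q})"]) (auto simp: power_divide)
  have y0K: "y0 c \<in> K" using c by (auto simp: K_def y0_def)
  obtain x' where x': "x' \<in> K" and max': "\<And>y. y \<in> K \<Longrightarrow> qform y y \<le> qform x' x'"
    using continuous_attains_sup[OF \<open>compact K\<close> _ contq] y0K by blast
  define x where "x i = \<bar>x' i\<bar>" for i
  have x: "x \<in> K" using x' by (auto simp: K_def x_def nform_def mult.assoc)
  have "qform x' x' \<le> qform x x"
    unfolding qform_def x_def
  proof (intro sum_mono)
    fix i j assume ij: "i \<in> {1..q}" "j \<in> {1..q}"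
    have "(lam i * lam j) * (x' i * x' j) \<le> (lam i * lam j) * (\<bar>x' i\<bar> * \<bar>x' j\<bar>)"
      using ij lam_pos by (intro mult_left_mono) (auto simp: less_imp_le simp flip: abs_mult)
    then show "of_bool (E i j) * (lam i * x' i) * (lam j * x' j) \<le> of_bool (E i j) * (lam i * \<bar>x' i\<bar>) * (lam j * \<bar>x' j\<bar>)"
      by (simp add: mult_ac)
  qed
  with max' have max: "qform y y \<le> qform x x" if "y \<in> K" for y using that by force
  define \<rho> where "\<rho> = qform x x"
  have "0 < qform (y0 c) (y0 c)"
  proof -
    have "0 < of_bool (E i0 j0) * (lam i0 * y0 c i0) * (lam j0 * y0 c j0)"
      using E0 i0 j0 c lam_pos by (simp add: y0_def)
    also have "\<dots> \<le> (\<Sum>j\<in>{1..q}. of_bool (E i0 j) * (lam i0 * y0 c i0) * (lam j * y0 c j))"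
      by (rule member_le_sum[where f="\<lambda>j. of_bool (E i0 j) * (lam i0 * y0 c i0) * (lam j * y0 c j)"])
         (use i0 j0 lam_pos c in \<open>auto simp: y0_def less_imp_le\<close>)
    also have "\<dots> \<le> qform (y0 c) (y0 c)" unfolding qform_def
      by (rule member_le_sum[where f="\<lambda>i. \<Sum>j\<in>{1..q}. of_bool (E i j) * (lam i * y0 c i) * (lam j * y0 c j)"])
         (use i0 j0 lam_pos c in \<open>auto simp: y0_def less_imp_le intro!: sum_nonneg\<close>)
    finally show ?thesis .
  qed
  with max[OF y0K] have \<rho>: "\<rho> > 0" by (simp add: \<rho>_def)
  \<comment> \<open>Homogeneity removes the norm constraint, so that the maximiser can be perturbed
    in every direction.\<close>
  have hom: "qform y y \<le> \<rho> * nform y y" for y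
  proof (cases "nform y y = 0")
    case True
    have "\<forall>i\<in>{1..q}. lam i * y i * y i = 0"
      using True unfolding nform_def
      by (subst (asm) sum_nonneg_eq_0_iff) (auto simp: mult.assoc lam_pos less_imp_le)
    then have "\<forall>i\<in>{1..q}. y i = 0" using lam_pos by force
    then have "qform y y = 0" unfolding qform_def by (intro sum.neutral ballI) auto
    then show ?thesis using True by simp
  next
    case False
    have "nform y y \<ge> 0" unfolding nform_def by (intro sum_nonneg) (auto simp: mult.assoc lam_pos less_imp_le)
    with False have pos: "nform y y > 0" by simp
    define s where "s = 1 / sqrt (nform y y)"
    have s2: "s\<^sup>2 = 1 / nform y y" using pos by (simp add: s_def power_divide)
    define z where "z i = (if i \<in> {1..q} then s * y i else 0)" for i
    have "nform z z = s\<^sup>2 * nform y y"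
      unfolding nform_def sum_distrib_left z_def by (intro sum.cong) (auto simp: power2_eq_square)
    moreover have qz: "qform z z = s\<^sup>2 * qform y y"
      unfolding qform_def sum_distrib_left z_def by (intro sum.cong) (auto simp: power2_eq_square)
    ultimately have "z \<in> K" using s2 pos by (auto simp: K_def z_def)
    from max[OF this] show ?thesis using qz s2 pos by (simp add: \<rho>_def field_simps)
  qed
  have crit: "qform x z = \<rho> * nform x z" for z
  proof (rule ccontr)
    define \<beta> where "\<beta> = qform x z - \<rho> * nform x z"
    define \<gamma> where "\<gamma> = qform z z - \<rho> * nform z z"
    \<comment> \<open>The denominator lets the linear term dominate: the change equals
      \<open>t\<^sup>2 * (2 * (\<bar>\<gamma>\<bar> + 1) + \<gamma>)\<close>, which is positive when
      \<open>\<beta>\<close> is nonzero.\<close>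
    define t where "t = \<beta> / (\<bar>\<gamma>\<bar> + 1)"
    assume "qform x z \<noteq> \<rho> * nform x z"
    then have "\<beta> \<noteq> 0" by (simp add: \<beta>_def)
    have "2 * t * \<beta> + t\<^sup>2 * \<gamma> \<le> 0"
      using hom[of "\<lambda>i. x i + t * z i"] x unfolding qform_add_scaled nform_add_scaled
      by (simp add: \<beta>_def \<gamma>_def \<rho>_def K_def algebra_simps)
    moreover have "t * \<beta> = t\<^sup>2 * (\<bar>\<gamma>\<bar> + 1)" by (simp add: t_def power2_eq_square)
    ultimately have "t\<^sup>2 * (2 * (\<bar>\<gamma>\<bar> + 1) + \<gamma>) \<le> 0" by (simp add: algebra_simps)
    moreover have "2 * (\<bar>\<gamma>\<bar> + 1) + \<gamma> > 0" by (cases "\<gamma> \<ge> 0") simp_all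
    moreover have "t\<^sup>2 > 0" using \<open>\<beta> \<noteq> 0\<close> by (simp add: t_def)
    ultimately show False using mult_pos_pos[of "t\<^sup>2" "2 * (\<bar>\<gamma>\<bar> + 1) + \<gamma>"] by linarith
  qed
  have eig: "(\<Sum>j\<in>{1..q}. of_bool (E i j) * lam j * x j) = \<rho> * x i" if i: "i \<in> {1..q}" for i
  proof -
    \<comment> \<open>Testing the critical-point identity against this vector reads off coordinate
      \<open>i\<close> of the eigenvector equation.\<close>
    define z where "z k = (if k = i then 1 / lam i else 0)" for k
    have "qform z x = (\<Sum>j\<in>{1..q}. of_bool (E i j) * lam j * x j)"
      unfolding qform_eq z_def using i lam_pos[OF i] by (simp add: if_distrib if_distribR cong: if_cong)
    moreover have "nform x z = x i"
      unfolding nform_def z_def using i lam_pos[OF i] by (simp add: if_distrib cong: if_cong)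
    ultimately show ?thesis using crit[of z] qform_commute[of x z] by simp
  qed
  \<comment> \<open>At a zero coordinate the eigenvector equation is a vanishing sum of nonnegative
    terms, so zeros spread to all nodes, against norm 1.\<close>
  have x_pos: "x i > 0" if i: "i \<in> {1..q}" for i
  proof (rule ccontr)
    assume "\<not> x i > 0"
    then have xi: "x i = 0" by (simp add: x_def)
    have "x j = 0" if j: "j \<in> {1..q}" for j
    proof (rule connected_propagate[where P="\<lambda>j. x j = 0", OF xi i j])
      fix k l assume kl: "E k l" "x k = 0"
      then have V: "k \<in> {1..q}" "l \<in> {1..q}" using E_dom by auto
      have "(\<Sum>j\<in>{1..q}. of_bool (E k j) * lam j * x j) = 0"
        using eig[OF V(1)] kl(2) by simp
      then have "\<forall>j\<in>{1..q}. of_bool (E k j) * lam j * x j = 0"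
        by (subst (asm) sum_nonneg_eq_0_iff) (auto simp: x_def lam_pos less_imp_le)
      then show "x l = 0" using V kl lam_pos[OF V(2)] by force
    qed
    then have "nform x x = 0" unfolding nform_def by (intro sum.neutral) auto
    then show False using x by (simp add: K_def)
  qed
  have "perron x \<rho>" unfolding perron_def
    using \<rho> x_pos eig x by (auto simp: K_def nform_def power2_eq_square mult.assoc)
  then show ?thesis by blast
qed

end

section \<open>Cylinder sets\<close>

lemma interval_splits:
  fixes a u b :: int
  assumes "a \<le> u" "u \<le> b"
  shows "{u} \<union> ({a..<u} \<union> {u<..b}) = {a..b}" "{u} \<union> {a..<u} = {a..u}" "{u} \<union> {u<..b} = {u..b}"
  using assms unfolding set_eq_iff Un_iff singleton_iff atLeastAtMost_iff atLeastLessThan_iff greaterThanAtMost_iff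
  by linarith+

context hom_model
begin

text \<open>Symmetry of \<open>E\<close> reduces both orientations to forward edges, and every site
  starts such an edge, which forces its value to be a node.\<close>

lemma Hom_iff: "\<phi> \<in> Hom q E \<longleftrightarrow> (\<forall>k. E (\<phi> k) (\<phi> (k + 1)))"
proof
  assume "\<phi> \<in> Hom q E"
  then show "\<forall>k. E (\<phi> k) (\<phi> (k + 1))" by (auto simp: Hom_def adjZ_def)
next
  assume *: "\<forall>k. E (\<phi> k) (\<phi> (k + 1))"
  have "E (\<phi> m) (\<phi> n)" if "adjZ m n" for m n
  proof -
    from that have "n = m + 1 \<or> m = n + 1" by (auto simp: adjZ_def)
    then show ?thesis using * E_sym by metis
  qed
  then show "\<phi> \<in> Hom q E" using * E_dom unfolding Hom_def by blast
qed

lemma Hom_range: "\<phi> \<in> Hom q E \<Longrightarrow> \<phi> k \<in> {1..q}"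
  by (auto simp: Hom_def)

lemma space_HomM [simp]: "space (HomM q E) = Hom q E"
  by (auto simp: HomM_def space_restrict_space space_PiM Hom_def)

lemma space_sigma_on [simp]: "space (sigma_on q E S) = Hom q E"
  by (simp add: sigma_on_def)

lemma measurable_restrict_sigma_on:
  "(\<lambda>\<phi>. restrict \<phi> S) \<in> measurable (sigma_on q E S) (PiM S (\<lambda>_. count_space {1..q}))"
  unfolding sigma_on_def by (rule measurable_vimage_algebra1) (use Hom_range in \<open>auto simp: space_PiM\<close>)

lemma measurable_sigma_on:
  assumes "k \<in> S"
  shows "(\<lambda>\<phi>. \<phi> k) \<in> measurable (sigma_on q E S) (count_space UNIV)"
proof -
  have "(\<lambda>\<phi>. restrict \<phi> S k) \<in> measurable (sigma_on q E S) (count_space {1..q})"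
    using measurable_compose[OF measurable_restrict_sigma_on measurable_component_singleton[OF assms]] .
  then have "(\<lambda>\<phi>. restrict \<phi> S k) \<in> measurable (sigma_on q E S) (count_space UNIV)"
    by (rule measurable_compose) simp
  then show ?thesis using assms by simp
qed

lemma sets_sigma_on_UNIV: "sets (sigma_on q E UNIV) = sets (HomM q E)"
proof -
  have "Hom q E \<subseteq> space (PiM UNIV (\<lambda>_. count_space {1..q}))"
    using Hom_range by (auto simp: space_PiM)
  from restrict_space_eq_vimage_algebra[OF this]
  show ?thesis unfolding sigma_on_def space_HomM restrict_UNIV unfolding HomM_def by (rule sym)
qed

lemma measurable_HomM: "(\<lambda>\<phi>. \<phi> k) \<in> measurable (HomM q E) (count_space UNIV)"
  using measurable_sigma_on[of k UNIV] measurable_cong_sets[OF sets_sigma_on_UNIV refl] by blast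

lemma measurable_into_sigma_on:
  assumes "space N = Hom q E" "\<And>k. k \<in> S \<Longrightarrow> (\<lambda>\<phi>. \<phi> k) \<in> measurable N (count_space UNIV)"
  shows "(\<lambda>\<phi>. restrict \<phi> S) \<in> measurable N (PiM S (\<lambda>_. count_space {1..q}))"
proof (rule measurable_restrict)
  fix k assume k: "k \<in> S"
  have "(\<lambda>\<phi>. \<phi> k) -` {a} \<inter> space N \<in> sets N" for a
    by (rule measurable_sets[OF assms(2)[OF k]]) simp
  then show "(\<lambda>\<phi>. \<phi> k) \<in> measurable N (count_space {1..q})"
    using Hom_range assms(1) by (subst measurable_count_space_eq2) auto
qed

lemma sets_sigma_on_subset_if:
  assumes "space N = Hom q E" "\<And>k. k \<in> S \<Longrightarrow> (\<lambda>\<phi>. \<phi> k) \<in> measurable N (count_space UNIV)"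
  shows "sets (sigma_on q E S) \<subseteq> sets N"
  unfolding sigma_on_def space_HomM
  by (rule sets_image_in_sets[OF assms(1)]) (use measurable_into_sigma_on[OF assms] in simp)

lemma sets_sigma_on_subset: "sets (sigma_on q E S) \<subseteq> sets (HomM q E)"
  by (rule sets_sigma_on_subset_if) (auto simp: measurable_HomM)

text \<open>\<open>x\<close> is total but only its values on \<open>S\<close> matter, so one
  \<open>x\<close> can describe cylinders over different windows.\<close>

definition cyl :: "int set \<Rightarrow> (int \<Rightarrow> nat) \<Rightarrow> (int \<Rightarrow> nat) set" where
  "cyl S x = {\<phi> \<in> Hom q E. \<forall>k\<in>S. \<phi> k = x k}"

lemma cyl_cong: "(\<And>k. k \<in> S \<Longrightarrow> x k = y k) \<Longrightarrow> cyl S x = cyl S y"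
  by (auto simp: cyl_def)

lemma cyl_in_sigma_on:
  assumes "S \<subseteq> T"
  shows "cyl S x \<in> sets (sigma_on q E T)"
proof -
  have "{\<phi> \<in> space (sigma_on q E T). k \<in> S \<longrightarrow> \<phi> k = x k} \<in> sets (sigma_on q E T)" for k
  proof (cases "k \<in> S")
    case True
    then have [measurable]: "(\<lambda>\<phi>. \<phi> k) \<in> measurable (sigma_on q E T) (count_space UNIV)"
      using assms by (intro measurable_sigma_on) auto
    show ?thesis by measurable
  qed (use sets.top[of "sigma_on q E T"] in simp)
  from sets.sets_Collect_countable_All[OF this] show ?thesis by (simp add: cyl_def Ball_def)
qed

lemma cyl_sets: "cyl S x \<in> sets (HomM q E)"
  using cyl_in_sigma_on[of S UNIV] sets_sigma_on_UNIV by auto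

lemma cyl_Int_mono:
  assumes "A \<subseteq> B"
  shows "cyl A x \<inter> cyl B y = (if \<forall>k\<in>A. x k = y k then cyl B y else {})"
proof (cases "\<forall>k\<in>A. x k = y k")
  case True
  then show ?thesis using assms by (auto simp: cyl_def)
next
  case False
  then obtain k where "k \<in> A" "k \<in> B" "x k \<noteq> y k" using assms by auto
  then have "cyl A x \<inter> cyl B y = {}" by (auto simp: cyl_def)
  then show ?thesis using False by auto
qed

lemma cyl_Int: "cyl S x \<inter> cyl T x = cyl (S \<union> T) x"
  by (auto simp: cyl_def)

text \<open>The windows are nested, so two such cylinders meet in one of them or not at all: a
  pi-system. The bound \<open>N\<close> allows windows to be restricted to those that contain a
  given finite set.\<close>

definition gen :: "int set \<Rightarrow> int \<Rightarrow> (int \<Rightarrow> nat) set set" where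
  "gen S N = insert {} {cyl (S \<inter> {-n..n}) x | n x. N \<le> n}"

lemma genI: "N \<le> n \<Longrightarrow> cyl (S \<inter> {-n..n}) x \<in> gen S N"
  by (auto simp: gen_def)

lemma genE:
  assumes "A \<in> gen S N"
  obtains "A = {}" | n x where "N \<le> n" "A = cyl (S \<inter> {-n..n}) x"
  using assms by (auto simp: gen_def)

lemma Int_stable_gen: "Int_stable (gen S N)"
proof (rule Int_stableI)
  fix A B assume "A \<in> gen S N" "B \<in> gen S N"
  then show "A \<inter> B \<in> gen S N"
  proof (elim genE)
    fix m x n y
    assume *: "N \<le> m" "A = cyl (S \<inter> {-m..m}) x" "N \<le> n" "B = cyl (S \<inter> {-n..n}) y"
    show ?thesis
    proof (cases "m \<le> n")
      case True
      then have "S \<inter> {-m..m} \<subseteq> S \<inter> {-n..n}" by auto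
      from cyl_Int_mono[OF this] show ?thesis using * genI by (auto simp: gen_def)
    next
      case False
      then have "S \<inter> {-n..n} \<subseteq> S \<inter> {-m..m}" by auto
      from cyl_Int_mono[OF this, of y x] show ?thesis using * genI by (auto simp: gen_def Int_commute)
    qed
  qed (auto simp: gen_def)
qed

lemma gen_subset: "gen S N \<subseteq> Pow (Hom q E)"
  by (auto simp: gen_def cyl_def)

lemma cyl_split:
  assumes "S \<inter> T = {}"
  shows "cyl S x = (\<Union>\<xi>\<in>PiE T (\<lambda>_. {1..q}). cyl (S \<union> T) (override_on x \<xi> T))"
proof (intro set_eqI iffI)
  fix \<phi> assume \<phi>: "\<phi> \<in> cyl S x"
  have "restrict \<phi> T \<in> PiE T (\<lambda>_. {1..q})"
    using \<phi> Hom_range by (auto simp: cyl_def)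
  moreover have "\<phi> \<in> cyl (S \<union> T) (override_on x (restrict \<phi> T) T)"
    using \<phi> by (auto simp: cyl_def override_on_def)
  ultimately show "\<phi> \<in> (\<Union>\<xi>\<in>PiE T (\<lambda>_. {1..q}). cyl (S \<union> T) (override_on x \<xi> T))" by blast
next
  fix \<phi> assume "\<phi> \<in> (\<Union>\<xi>\<in>PiE T (\<lambda>_. {1..q}). cyl (S \<union> T) (override_on x \<xi> T))"
  then show "\<phi> \<in> cyl S x" using assms by (auto simp: cyl_def override_on_def)
qed

lemma gen_cover:
  obtains C where "C \<subseteq> gen S N" "\<Union>C = Hom q E" "countable C"
proof
  let ?T = "S \<inter> {-N..N}"
  let ?C = "cyl ?T ` PiE ?T (\<lambda>_. {1..q})"
  have "finite (PiE ?T (\<lambda>_. {1..q}))" by (intro finite_PiE) auto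
  then show "countable ?C" by (intro countable_finite) auto
  show "?C \<subseteq> gen S N" using genI by auto
  have "cyl ?T (override_on undefined \<xi> ?T) = cyl ?T \<xi>" for \<xi> by (rule cyl_cong) auto
  then show "\<Union>?C = Hom q E" using cyl_split[of "{}" ?T undefined] by (simp add: cyl_def)
qed

text \<open>Any site \<open>k\<close> of \<open>S\<close> lies in a window of radius at least
  \<open>N\<close>, and an event about its value is a finite union of cylinders over that
  window.\<close>

lemma sets_sigma_on: "sets (sigma_on q E S) = sigma_sets (Hom q E) (gen S N)"
proof
  show "sigma_sets (Hom q E) (gen S N) \<subseteq> sets (sigma_on q E S)"
  proof -
    have "gen S N \<subseteq> sets (sigma_on q E S)"
      by (auto elim!: genE intro!: cyl_in_sigma_on)
    from sets.sigma_sets_subset[OF this] show ?thesis by simp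
  qed
  have sp: "space (sigma (Hom q E) (gen S N)) = Hom q E"
    by (rule space_measure_of[OF gen_subset])
  have st: "sets (sigma (Hom q E) (gen S N)) = sigma_sets (Hom q E) (gen S N)"
    by (rule sets_measure_of[OF gen_subset])
  have "(\<lambda>\<phi>. \<phi> k) \<in> measurable (sigma (Hom q E) (gen S N)) (count_space UNIV)" if k: "k \<in> S" for k
  proof -
    define n where "n = max \<bar>k\<bar> N"
    let ?T = "S \<inter> {-n..n}"
    have kT: "k \<in> ?T" using k by (auto simp: n_def)
    have "{\<phi> \<in> Hom q E. \<phi> k = i} \<in> sigma_sets (Hom q E) (gen S N)" for i
    proof -
      let ?X = "{\<xi> \<in> PiE ?T (\<lambda>_. {1..q}). \<xi> k = i}"
      have "finite (PiE ?T (\<lambda>_. {1..q}))" by (intro finite_PiE) auto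
      then have fin: "finite ?X" by auto
      have "{\<phi> \<in> Hom q E. \<phi> k = i} = (\<Union>\<xi>\<in>?X. cyl ?T \<xi>)"
      proof (intro set_eqI iffI)
        fix \<phi> assume \<phi>: "\<phi> \<in> {\<phi> \<in> Hom q E. \<phi> k = i}"
        have "restrict \<phi> ?T \<in> ?X" using \<phi> Hom_range kT by auto
        moreover have "\<phi> \<in> cyl ?T (restrict \<phi> ?T)" using \<phi> by (auto simp: cyl_def)
        ultimately show "\<phi> \<in> (\<Union>\<xi>\<in>?X. cyl ?T \<xi>)" by blast
      next
        fix \<phi> assume "\<phi> \<in> (\<Union>\<xi>\<in>?X. cyl ?T \<xi>)"
        then show "\<phi> \<in> {\<phi> \<in> Hom q E. \<phi> k = i}" using kT by (auto simp: cyl_def)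
      qed
      also have "\<dots> \<in> sets (sigma (Hom q E) (gen S N))"
        using fin
      proof (rule sets.finite_UN)
        fix \<xi>
        have "N \<le> n" by (simp add: n_def)
        then show "cyl ?T \<xi> \<in> sets (sigma (Hom q E) (gen S N))"
          unfolding st by (intro sigma_sets.Basic genI)
      qed
      finally show ?thesis by (simp only: st)
    qed
    then show ?thesis
      unfolding measurable_count_space_eq2_countable sp st
      by (auto simp: vimage_def Int_def conj_commute)
  qed
  from sets_sigma_on_subset_if[OF sp this] st
  show "sets (sigma_on q E S) \<subseteq> sigma_sets (Hom q E) (gen S N)" by simp
qed

text \<open>The pi-system argument in the form used throughout: with \<open>S = UNIV\<close> for
  invariance and uniqueness, and with the complement of a patch for conditional
  expectations.\<close>

lemma measure_eqI_cyl:
  assumes "sets M = sets (sigma_on q E S)" "sets N = sets (sigma_on q E S)" "finite_measure M"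
    and eq: "\<And>n x. n0 \<le> n \<Longrightarrow> emeasure M (cyl (S \<inter> {-n..n}) x) = emeasure N (cyl (S \<inter> {-n..n}) x)"
  shows "M = N"
proof -
  interpret M: finite_measure M by fact
  obtain C where C: "C \<subseteq> gen S n0" "\<Union>C = Hom q E" "countable C" by (rule gen_cover)
  show ?thesis
  proof (rule measure_eqI_generator_eq_countable[OF Int_stable_gen[of S n0] gen_subset _ _ _ C])
    show "emeasure M X = emeasure N X" if "X \<in> gen S n0" for X
      using that by (elim genE) (simp_all add: eq)
  qed (use assms sets_sigma_on in auto)
qed

text \<open>Increments are 1 or -1, and injectivity forbids turning back, since
  \<open>\<alpha> (m + 2)\<close> differs from \<open>\<alpha> m\<close>; so the increment is
  constant.\<close>

lemma board_aut_iff: "board_aut \<alpha> \<longleftrightarrow> (\<exists>c. \<alpha> = (\<lambda>k. c + k) \<or> \<alpha> = (\<lambda>k. c - k))"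
proof
  assume "\<exists>c. \<alpha> = (\<lambda>k. c + k) \<or> \<alpha> = (\<lambda>k. c - k)"
  then obtain c where "\<alpha> = (\<lambda>k. c + k) \<or> \<alpha> = (\<lambda>k. c - k)" by blast
  moreover have "bij (\<lambda>k. c + k)"
    by (rule bij_betw_byWitness[where f'="\<lambda>k. k - c"]) auto
  moreover have "bij (\<lambda>k. c - k)"
    by (rule bij_betw_byWitness[where f'="\<lambda>k. c - k"]) auto
  ultimately show "board_aut \<alpha>"
    by (auto simp: board_aut_def adjZ_def)
next
  assume \<alpha>: "board_aut \<alpha>"
  then have inj: "\<alpha> m = \<alpha> n \<Longrightarrow> m = n" for m n by (auto simp: board_aut_def bij_def inj_def)
  have step: "\<bar>\<alpha> (m + 1) - \<alpha> m\<bar> = 1" for m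
    using \<alpha> unfolding board_aut_def adjZ_def by (metis abs_1 add_diff_cancel_left')
  have lin: "\<alpha> (m + 1) - \<alpha> m = \<alpha> (m + 2) - \<alpha> (m + 1)" for m
  proof -
    have "\<alpha> (m + 2) \<noteq> \<alpha> m" using inj[of "m + 2" m] by auto
    then show ?thesis using step[of m] step[of "m + 1"] by (simp add: add.assoc)
  qed
  define s where "s = \<alpha> 1 - \<alpha> 0"
  have const: "\<alpha> (m + 1) - \<alpha> m = s" for m
  proof (induction m rule: int_induct[where k=0])
    case base
    show ?case by (simp add: s_def)
  next
    case (step1 i)
    then show ?case using lin[of i] by (simp add: add.assoc)
  next
    case (step2 i)
    then show ?case using lin[of "i - 1"] by (simp add: algebra_simps)
  qed
  have "\<alpha> m = \<alpha> 0 + s * m" for m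
  proof (induction m rule: int_induct[where k=0])
    case (step1 i)
    then show ?case using const[of i] by (simp add: algebra_simps)
  next
    case (step2 i)
    then show ?case using const[of "i - 1"] by (simp add: algebra_simps)
  qed simp
  then have "\<alpha> = (\<lambda>m. \<alpha> 0 + s * m)" by blast
  moreover have "s = 1 \<or> s = -1" using step[of 0] by (auto simp: s_def)
  ultimately have "\<alpha> = (\<lambda>k. \<alpha> 0 + k) \<or> \<alpha> = (\<lambda>k. \<alpha> 0 - k)"
    by (metis (no_types, lifting) diff_conv_add_uminus mult_1 mult_minus1)
  then show "\<exists>c. \<alpha> = (\<lambda>k. c + k) \<or> \<alpha> = (\<lambda>k. c - k)" by blast
qed

lemma comp_Hom:
  assumes "board_aut \<alpha>" "\<phi> \<in> Hom q E"
  shows "\<phi> \<circ> \<alpha> \<in> Hom q E"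
  using assms by (auto simp: Hom_def board_aut_def)

lemma measurable_into_HomM:
  assumes "f \<in> space N \<rightarrow> Hom q E" "\<And>k. (\<lambda>\<omega>. f \<omega> k) \<in> measurable N (count_space UNIV)"
  shows "f \<in> measurable N (HomM q E)"
proof -
  have rng: "f \<omega> k \<in> {1..q}" if "\<omega> \<in> space N" for \<omega> k
    using assms(1) that by (intro Hom_range) auto
  have "(\<lambda>\<omega> k. f \<omega> k) \<in> measurable N (PiM UNIV (\<lambda>_. count_space {1..q}))"
  proof (rule measurable_PiM_single')
    fix k
    have "(\<lambda>\<omega>. f \<omega> k) -` {a} \<inter> space N \<in> sets N" for a
      by (rule measurable_sets[OF assms(2)]) simp
    then show "(\<lambda>\<omega>. f \<omega> k) \<in> measurable N (count_space {1..q})"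
      using rng by (subst measurable_count_space_eq2) (auto simp del: atLeastAtMost_iff)
  next
    show "(\<lambda>\<omega> k. f \<omega> k) \<in> space N \<rightarrow> (\<Pi>\<^sub>E k\<in>UNIV. space (count_space {1..q}))"
      using rng by (auto simp del: atLeastAtMost_iff)
  qed
  then show ?thesis
    using assms(1) unfolding HomM_def by (auto intro!: measurable_restrict_space2)
qed

lemma measurable_comp_HomM:
  assumes "board_aut \<alpha>"
  shows "(\<lambda>\<phi>. \<phi> \<circ> \<alpha>) \<in> measurable (HomM q E) (HomM q E)"
  using comp_Hom[OF assms] measurable_HomM by (intro measurable_into_HomM) auto

lemma pred_in_Hom:
  assumes "\<And>k. (\<lambda>\<omega>. f \<omega> k) \<in> measurable N (count_space UNIV)"
  shows "Measurable.pred N (\<lambda>\<omega>. f \<omega> \<in> Hom q E)"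
proof -
  note [measurable] = assms
  have "(\<lambda>\<omega>. f \<omega> \<in> Hom q E) = (\<lambda>\<omega>. \<forall>k. \<exists>i j. E i j \<and> f \<omega> k = i \<and> f \<omega> (k + 1) = j)"
    by (auto simp: Hom_iff)
  also have "Measurable.pred N \<dots>" by measurable
  finally show ?thesis .
qed

end

section \<open>Measures on homomorphisms and simplicity in terms of windows\<close>

locale hom_measure = hom_model +
  fixes \<mu> :: "(int \<Rightarrow> nat) measure"
  assumes \<mu>: "measure_on_Hom q E \<mu>"
begin

sublocale prob_space \<mu> using \<mu> by (simp add: measure_on_Hom_def)

lemma sets_mu: "sets \<mu> = sets (HomM q E)"
  using \<mu> by (simp add: measure_on_Hom_def)

lemma space_mu: "space \<mu> = Hom q E"
  using sets_eq_imp_space_eq[OF sets_mu] by simp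

lemma cyl_events [simp]: "cyl S x \<in> events"
  using cyl_sets by (simp add: sets_mu)

lemma subalgebra_sigma_on: "subalgebra \<mu> (sigma_on q E S)"
  using sets_sigma_on_subset by (simp add: subalgebra_def space_mu sets_mu)

lemma cyl_sum:
  assumes "S \<inter> T = {}" "finite T"
  shows "prob (cyl S x) = (\<Sum>\<xi>\<in>PiE T (\<lambda>_. {1..q}). prob (cyl (S \<union> T) (override_on x \<xi> T)))"
proof -
  have "disjoint_family_on (\<lambda>\<xi>. cyl (S \<union> T) (override_on x \<xi> T)) (PiE T (\<lambda>_. {1..q}))"
  proof (unfold disjoint_family_on_def, intro ballI impI)
    fix \<xi> \<xi>' assume *: "\<xi> \<in> PiE T (\<lambda>_. {1..q})" "\<xi>' \<in> PiE T (\<lambda>_. {1..q})" "\<xi> \<noteq> \<xi>'"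
    then obtain k where "k \<in> T" "\<xi> k \<noteq> \<xi>' k" by (metis PiE_ext)
    then show "cyl (S \<union> T) (override_on x \<xi> T) \<inter> cyl (S \<union> T) (override_on x \<xi>' T) = {}"
      by (auto simp: cyl_def) (metis UnI2 override_on_apply_in)
  qed
  then show ?thesis
    unfolding cyl_split[OF assms(1), of x]
    using assms(2) by (intro finite_measure_finite_Union) (auto intro!: finite_PiE)
qed

lemma sum_PiE_singleton:
  "(\<Sum>\<xi>\<in>PiE {k} (\<lambda>_. A). f \<xi>) = (\<Sum>j\<in>A. f (\<lambda>l\<in>{k}. j))"
proof -
  have *: "(\<lambda>l\<in>{k}. \<xi> k) = \<xi>" if "\<xi> \<in> PiE {k} (\<lambda>_. A)" for \<xi>
    using that by (auto simp: fun_eq_iff PiE_def extensional_def)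
  show ?thesis
    by (rule sum.reindex_bij_witness[of _ "\<lambda>j. \<lambda>l\<in>{k}. j" "\<lambda>\<xi>. \<xi> k"]) (auto simp only: *, auto split: if_splits)
qed

lemma cyl_sum1:
  assumes "k \<notin> S"
  shows "prob (cyl S x) = (\<Sum>j\<in>{1..q}. prob (cyl (insert k S) (x(k := j))))"
proof -
  have "prob (cyl S x) = (\<Sum>j\<in>{1..q}. prob (cyl (S \<union> {k}) (override_on x (\<lambda>l\<in>{k}. j) {k})))"
    using cyl_sum[of S "{k}" x] assms unfolding sum_PiE_singleton by simp
  moreover have "override_on x (\<lambda>l\<in>{k}. j) {k} = x(k := j)" for j by (auto simp: override_on_def)
  ultimately show ?thesis by simp
qed

lemma prob_cyl_aut:
  assumes "invariant q E \<mu>" and \<alpha>: "board_aut \<alpha>"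
  shows "prob (cyl S (x \<circ> \<alpha>)) = prob (cyl (\<alpha> ` S) x)"
proof -
  have "prob (cyl S (x \<circ> \<alpha>)) = measure (distr \<mu> (HomM q E) (\<lambda>\<phi>. \<phi> \<circ> \<alpha>)) (cyl S (x \<circ> \<alpha>))"
    using assms by (simp add: invariant_def)
  also have "\<dots> = prob ((\<lambda>\<phi>. \<phi> \<circ> \<alpha>) -` cyl S (x \<circ> \<alpha>) \<inter> space \<mu>)"
    using measurable_comp_HomM[OF \<alpha>] measurable_cong_sets[OF sets_mu refl]
    by (intro measure_distr cyl_sets) auto
  also have "(\<lambda>\<phi>. \<phi> \<circ> \<alpha>) -` cyl S (x \<circ> \<alpha>) \<inter> space \<mu> = cyl (\<alpha> ` S) x"
    using comp_Hom[OF \<alpha>] by (auto simp: cyl_def space_mu)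
  finally show ?thesis .
qed

text \<open>Conditional independence at \<open>u\<close>, applied to the events fixing the window on
  either side and multiplied by the squared probability of the value at \<open>u\<close>. The
  product form remains valid when that probability is 0, as both sides then vanish.\<close>

lemma simple_split:
  assumes "simple q E \<mu>" "a \<le> u" "u \<le> b"
  shows "prob (cyl {a..b} x) * prob (cyl {u} x) = prob (cyl {a..u} x) * prob (cyl {u..b} x)"
proof (cases "prob (cyl {u} x) = 0")
  case True
  have "prob (cyl {a..u} x) \<le> prob (cyl {u} x)"
    using assms by (intro finite_measure_mono[OF _ cyl_events]) (auto simp: cyl_def)
  then show ?thesis using True by (simp add: measure_le_0_iff)
next
  case False
  define C where "C = cyl {u} x"
  have C: "{\<phi> \<in> space \<mu>. \<phi> u = x u} = C" by (auto simp: C_def cyl_def space_mu)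
  have Cev: "C \<in> events" by (simp add: C_def)
  have Cpos: "emeasure \<mu> C > 0" "prob C \<noteq> 0" using False by (auto simp: C_def emeasure_eq_measure zero_less_measure_iff)
  let ?U = "uniform_measure \<mu> C"
  interpret U: prob_space ?U
    using Cpos by (intro prob_space_uniform_measure) (auto simp: emeasure_eq_measure)
  let ?L = "PiM {..<u} (\<lambda>_. count_space {1..q})" and ?R = "PiM {u<..} (\<lambda>_. count_space {1..q})"
  have ind: "U.indep_var ?L (\<lambda>\<phi>. restrict \<phi> {..<u}) ?R (\<lambda>\<phi>. restrict \<phi> {u<..})"
    using assms(1)[unfolded simple_def Let_def, rule_format, of u "x u", unfolded C] Cpos(1) by blast
  define A where "A = {f \<in> space ?L. \<forall>k\<in>{a..<u}. f k = x k}"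
  define B where "B = {f \<in> space ?R. \<forall>k\<in>{u<..b}. f k = x k}"
  have "Measurable.pred ?L (\<lambda>f. f k = x k)" if "k \<in> {a..<u}" for k
  proof -
    have [measurable]: "(\<lambda>f. f k) \<in> measurable ?L (count_space {1..q})"
      using that by (intro measurable_component_singleton) auto
    have [measurable]: "(\<lambda>i::nat. i = x k) \<in> measurable (count_space {1..q}) (count_space UNIV)" by simp
    show ?thesis by measurable
  qed
  then have A: "A \<in> sets ?L"
    unfolding A_def by (intro sets.sets_Collect_finite_All) (auto simp: pred_def)
  have "Measurable.pred ?R (\<lambda>f. f k = x k)" if "k \<in> {u<..b}" for k
  proof -
    have [measurable]: "(\<lambda>f. f k) \<in> measurable ?R (count_space {1..q})"
      using that by (intro measurable_component_singleton) auto
    have [measurable]: "(\<lambda>i::nat. i = x k) \<in> measurable (count_space {1..q}) (count_space UNIV)" by simp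
    show ?thesis by measurable
  qed
  then have B: "B \<in> sets ?R"
    unfolding B_def by (intro sets.sets_Collect_finite_All) (auto simp: pred_def)
  have preA: "(\<lambda>\<phi>. restrict \<phi> {..<u}) -` A \<inter> space \<mu> = cyl {a..<u} x"
    using Hom_range by (auto simp: A_def cyl_def space_mu space_PiM)
  have preB: "(\<lambda>\<phi>. restrict \<phi> {u<..}) -` B \<inter> space \<mu> = cyl {u<..b} x"
    using Hom_range by (auto simp: B_def cyl_def space_mu space_PiM)
  have "(\<lambda>\<phi>. (restrict \<phi> {..<u}, restrict \<phi> {u<..})) -` (A \<times> B) \<inter> space \<mu> = cyl {a..<u} x \<inter> cyl {u<..b} x"
    using preA preB by blast
  then have "U.prob (cyl {a..<u} x \<inter> cyl {u<..b} x) = U.prob (cyl {a..<u} x) * U.prob (cyl {u<..b} x)"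
    using U.indep_varD[OF ind A B] preA preB by simp
  moreover have ivl: "{u} \<union> ({a..<u} \<union> {u<..b}) = {a..b}" "{u} \<union> {a..<u} = {a..u}" "{u} \<union> {u<..b} = {u..b}"
    using interval_splits[OF assms(2,3)] .
  have "C \<inter> (cyl {a..<u} x \<inter> cyl {u<..b} x) = cyl {a..b} x" "C \<inter> cyl {a..<u} x = cyl {a..u} x"
      "C \<inter> cyl {u<..b} x = cyl {u..b} x"
    unfolding C_def cyl_Int ivl by simp_all
  ultimately have "prob (cyl {a..b} x) / prob C = prob (cyl {a..u} x) / prob C * (prob (cyl {u..b} x) / prob C)"
    using Cev Cpos sets.Int[OF cyl_events cyl_events, of "{a..<u}" x "{u<..b}" x] by simp
  then show ?thesis using Cpos(2) by (simp add: field_simps C_def)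
qed

text \<open>The window identity gives independence for the cylinders on the two sides of
  \<open>u\<close>; these are pi-systems, so it extends to the generated sigma-algebras.\<close>

lemma simpleI:
  assumes split: "\<And>a u b x. a \<le> u \<Longrightarrow> u \<le> b \<Longrightarrow>
    prob (cyl {a..b} x) * prob (cyl {u} x) = prob (cyl {a..u} x) * prob (cyl {u..b} x)"
  shows "simple q E \<mu>"
  unfolding simple_def Let_def
proof (intro allI impI)
  fix u i
  define C where "C = {\<phi> \<in> space \<mu>. \<phi> u = i}"
  assume "emeasure \<mu> {\<phi> \<in> space \<mu>. \<phi> u = i} > 0"
  then have Cpos: "emeasure \<mu> C > 0" "prob C > 0" by (auto simp: C_def emeasure_eq_measure)
  have C: "C = cyl {u} (\<lambda>_. i)" by (auto simp: C_def cyl_def space_mu)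
  have Cev: "C \<in> events" by (simp add: C)
  let ?U = "uniform_measure \<mu> C"
  interpret U: prob_space ?U
    using Cpos by (intro prob_space_uniform_measure) (auto simp: emeasure_eq_measure)
  let ?L = "PiM {..<u} (\<lambda>_. count_space {1..q})" and ?R = "PiM {u<..} (\<lambda>_. count_space {1..q})"
  have meas: "(\<lambda>\<phi>. restrict \<phi> S) \<in> measurable ?U (PiM S (\<lambda>_. count_space {1..q}))" for S
  proof (rule measurable_into_sigma_on)
    have eq: "measurable ?U (count_space UNIV) = measurable (HomM q E) (count_space UNIV :: nat measure)"
      by (rule measurable_cong_sets) (simp_all add: sets_mu)
    show "(\<lambda>\<phi>. \<phi> k) \<in> measurable ?U (count_space UNIV)" for k
      unfolding eq by (rule measurable_HomM)
  qed (simp add: space_mu)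
  have sig: "sigma_sets (space ?U) {(\<lambda>\<phi>. restrict \<phi> S) -` A \<inter> space ?U |A. A \<in> sets (PiM S (\<lambda>_. count_space {1..q}))}
      = sigma_sets (space ?U) (gen S \<bar>u\<bar>)" for S
    using sets_sigma_on[of S "\<bar>u\<bar>"] unfolding sigma_on_def sets_vimage_algebra by (simp add: space_mu)
  have gen_ev: "gen S \<bar>u\<bar> \<subseteq> U.events" for S
    by (auto elim!: genE)
  have "U.indep_set (gen {..<u} \<bar>u\<bar>) (gen {u<..} \<bar>u\<bar>)"
  proof (rule U.indep_setI[OF gen_ev gen_ev])
    fix A B assume "A \<in> gen {..<u} \<bar>u\<bar>" "B \<in> gen {u<..} \<bar>u\<bar>"
    then show "U.prob (A \<inter> B) = U.prob A * U.prob B"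
    proof (elim genE)
      fix m y n z
      assume *: "\<bar>u\<bar> \<le> m" "A = cyl ({..<u} \<inter> {-m..m}) y" "\<bar>u\<bar> \<le> n" "B = cyl ({u<..} \<inter> {-n..n}) z"
      \<comment> \<open>The two half-windows and the value at \<open>u\<close> are glued into one
        configuration. Since \<open>\<bar>u\<bar>\<close> bounds both radii from below, the
        half-windows end right next to \<open>u\<close>.\<close>
      define x where "x k = (if k < u then y k else if k = u then i else z k)" for k
      have "C \<inter> (A \<inter> B) = cyl {-m..n} x" "C \<inter> A = cyl {-m..u} x" "C \<inter> B = cyl {u..n} x" "C = cyl {u} x"
      proof -
        have A: "A = cyl {-m..<u} x"
          unfolding *(2) using *(1) by (auto simp: cyl_def x_def)
        have B: "B = cyl {u<..n} x"
          unfolding *(4) using *(3) by (auto simp: cyl_def x_def)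
        show C': "C = cyl {u} x"
          unfolding C by (rule cyl_cong) (simp add: x_def)
        have ivl: "{u} \<union> ({-m..<u} \<union> {u<..n}) = {-m..n}" "{u} \<union> {-m..<u} = {-m..u}" "{u} \<union> {u<..n} = {u..n}"
          using interval_splits[of "-m" u n] *(1,3) by auto
        show "C \<inter> (A \<inter> B) = cyl {-m..n} x" "C \<inter> A = cyl {-m..u} x" "C \<inter> B = cyl {u..n} x"
          unfolding A B C' cyl_Int ivl by simp_all
      qed
      moreover have "prob (cyl {-m..n} x) * prob (cyl {u} x) = prob (cyl {-m..u} x) * prob (cyl {u..n} x)"
        using * by (intro split) auto
      moreover have "A \<in> events" "B \<in> events" using * by auto
      ultimately show ?thesis using Cev Cpos by (simp add: field_simps)
    qed auto
  qed
  from U.indep_set_sigma_sets[OF this Int_stable_gen Int_stable_gen]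
  show "U.indep_var ?L (\<lambda>\<phi>. restrict \<phi> {..<u}) ?R (\<lambda>\<phi>. restrict \<phi> {u<..})"
    using meas by (simp only: U.indep_var_eq sig)
qed

end

section \<open>Uniqueness of the edge weights\<close>

lemma finite_bdry: "finite U \<Longrightarrow> finite (bdry U)"
proof (rule finite_subset)
  show "bdry U \<subseteq> (\<lambda>k. k + 1) ` U \<union> (\<lambda>k. k - 1) ` U"
  proof
    fix v assume "v \<in> bdry U"
    then obtain u where "u \<in> U" "\<bar>v - u\<bar> = 1" by (auto simp: bdry_def adjZ_def)
    then show "v \<in> (\<lambda>k. k + 1) ` U \<union> (\<lambda>k. k - 1) ` U"
      by (cases "v = u + 1") (auto intro: image_eqI[of _ _ u])
  qed
qed auto

context hom_model
begin

section \<open>Window weights and finite-volume conditional probabilities\<close>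

definition wt :: "(nat \<Rightarrow> real) \<Rightarrow> real \<Rightarrow> int \<Rightarrow> int \<Rightarrow> (int \<Rightarrow> nat) \<Rightarrow> real" where
  "wt h \<rho> a b x = of_bool (\<forall>k\<in>{a..<b}. E (x k) (x (k + 1))) * h (x a) * h (x b) *
     (\<Prod>k\<in>{a..b}. lam (x k)) / \<rho> ^ nat (b - a)"

text \<open>The one-site marginal; the normalisation in \<open>perron\<close> says that it sums to
  1.\<close>

lemma wt_refl: "wt h \<rho> a a x = lam (x a) * (h (x a))\<^sup>2"
  by (simp add: wt_def power2_eq_square)

text \<open>The old end loses its factor \<open>h\<close>, which moves to the new end. Multiplying
  by \<open>h (x b)\<close> instead of dividing covers values where \<open>h\<close>
  vanishes.\<close>

lemma wt_extend_right:
  assumes "a \<le> b"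
  shows "wt h \<rho> a (b + 1) x * h (x b) =
    wt h \<rho> a b x * (of_bool (E (x b) (x (b + 1))) * lam (x (b + 1)) * h (x (b + 1))) / \<rho>"
proof -
  have "{a..<b + 1} = insert b {a..<b}" "{a..b + 1} = insert (b + 1) {a..b}" using assms by auto
  moreover have "nat (b + 1 - a) = Suc (nat (b - a))" using assms by simp
  ultimately show ?thesis by (simp add: wt_def mult_ac)
qed

lemma wt_extend_left:
  assumes "a \<le> b"
  shows "wt h \<rho> (a - 1) b x * h (x a) =
    wt h \<rho> a b x * (of_bool (E (x (a - 1)) (x a)) * lam (x (a - 1)) * h (x (a - 1))) / \<rho>"
proof -
  have "{a - 1..<b} = insert (a - 1) {a..<b}" "{a - 1..b} = insert (a - 1) {a..b}" using assms by auto
  moreover have "nat (b - (a - 1)) = Suc (nat (b - a))" using assms by simp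
  ultimately show ?thesis by (simp add: wt_def mult_ac)
qed

text \<open>The unnormalised weight of placing \<open>\<xi>\<close> on \<open>U\<close> inside
  \<open>\<psi>\<close>. Admissibility is tested on the whole board instead of on
  \<open>closure_plus U\<close>, which for a homomorphism \<open>\<psi>\<close> is the same
  condition.\<close>

definition loc :: "int set \<Rightarrow> (int \<Rightarrow> nat) \<Rightarrow> (int \<Rightarrow> nat) \<Rightarrow> real" where
  "loc U \<xi> \<psi> = of_bool (override_on \<psi> \<xi> U \<in> Hom q E) * (\<Prod>k\<in>U. lam (\<xi> k))"

lemma loc_nonneg:
  assumes "\<xi> \<in> PiE U (\<lambda>_. {1..q})"
  shows "0 \<le> loc U \<xi> \<psi>"
proof -
  have "0 \<le> lam (\<xi> k)" if "k \<in> U" for k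
    using lam_pos[OF PiE_mem[OF assms that]] by simp
  then show ?thesis unfolding loc_def by (intro mult_nonneg_nonneg prod_nonneg) auto
qed

lemma loc_self: "\<psi> \<in> Hom q E \<Longrightarrow> loc U \<psi> \<psi> = (\<Prod>k\<in>U. lam (\<psi> k))"
proof -
  have "override_on \<psi> \<psi> U = \<psi>" by (auto simp: override_on_def)
  then show "\<psi> \<in> Hom q E \<Longrightarrow> ?thesis" by (simp add: loc_def)
qed

lemma sum_loc_pos:
  assumes "\<psi> \<in> Hom q E" "finite U"
  shows "0 < (\<Sum>\<xi>\<in>PiE U (\<lambda>_. {1..q}). loc U \<xi> \<psi>)"
proof (rule sum_pos2[of _ "restrict \<psi> U"])
  show "restrict \<psi> U \<in> PiE U (\<lambda>_. {1..q})" using Hom_range[OF assms(1)] by auto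
  have "override_on \<psi> (restrict \<psi> U) U = \<psi>" by (auto simp: override_on_def)
  then show "0 < loc U (restrict \<psi> U) \<psi>"
    using assms lam_pos Hom_range unfolding loc_def by (auto intro!: prod_pos)
qed (use assms loc_nonneg in \<open>auto intro!: finite_PiE\<close>)

text \<open>The boundary sites contribute the same factor to every admissible configuration on
  \<open>closure_plus U\<close>, so it cancels; restricting to \<open>U\<close> and overriding
  \<open>\<psi>\<close> identify these configurations with the admissible
  \<open>\<xi>\<close>.\<close>

lemma lam_cond_eq:
  assumes \<psi>: "\<psi> \<in> Hom q E" and U: "finite U"
  shows "lam_cond q E lam U \<psi> = loc U \<psi> \<psi> / (\<Sum>\<xi>\<in>PiE U (\<lambda>_. {1..q}). loc U \<xi> \<psi>)"
proof -
  define B where "B = closure_plus U"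
  have B: "B = U \<union> bdry U" "finite B" "U \<inter> bdry U = {}"
    using finite_UnI[OF U finite_bdry[OF U]] by (auto simp: B_def closure_plus_def bdry_def)
  have fin: "finite (HomFin q E B)"
    by (rule finite_subset[of _ "PiE B (\<lambda>_. {1..q})"]) (auto simp: HomFin_def B(2) intro!: finite_PiE)
  have wpos: "0 < weight lam B \<phi>" if "\<phi> \<in> HomFin q E B" for \<phi>
    using that lam_pos by (auto simp: weight_def HomFin_def PiE_iff intro!: prod_pos)
  have \<psi>B: "restrict \<psi> B \<in> HomFin q E B"
    using \<psi> by (auto simp: HomFin_def Hom_def)
  define EvU where "EvU = {\<phi>. \<forall>v\<in>U. \<phi> v = \<psi> v}"
  define EvD where "EvD = {\<phi>. \<forall>v\<in>bdry U. \<phi> v = \<psi> v}"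
  have "0 < (\<Sum>\<phi>\<in>HomFin q E B. weight lam B \<phi>)"
    by (rule sum_pos2[OF fin \<psi>B]) (auto simp: wpos \<psi>B less_imp_le)
  then have "lam_cond q E lam U \<psi> =
      (\<Sum>\<phi>\<in>EvU \<inter> EvD \<inter> HomFin q E B. weight lam B \<phi>) / (\<Sum>\<phi>\<in>EvD \<inter> HomFin q E B. weight lam B \<phi>)"
    by (simp add: lam_cond_def lam_prob_def Let_def EvU_def EvD_def B_def)
  also have "EvU \<inter> EvD \<inter> HomFin q E B = {restrict \<psi> B}"
  proof (intro set_eqI iffI)
    fix \<phi> assume "\<phi> \<in> EvU \<inter> EvD \<inter> HomFin q E B"
    then have "\<phi> k = restrict \<psi> B k" for k
      by (cases "k \<in> B") (auto simp: EvU_def EvD_def HomFin_def B PiE_def extensional_def)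
    then show "\<phi> \<in> {restrict \<psi> B}" by auto
  qed (use \<psi>B in \<open>auto simp: EvU_def EvD_def B\<close>)
  also have "(\<Sum>\<phi>\<in>{restrict \<psi> B}. weight lam B \<phi>) = (\<Prod>v\<in>bdry U. lam (\<psi> v)) * loc U \<psi> \<psi>"
    using B U finite_bdry[OF U] by (simp add: weight_def loc_self[OF \<psi>] prod.union_disjoint)
  also have "(\<Sum>\<phi>\<in>EvD \<inter> HomFin q E B. weight lam B \<phi>) =
      (\<Prod>v\<in>bdry U. lam (\<psi> v)) * (\<Sum>\<xi>\<in>PiE U (\<lambda>_. {1..q}). loc U \<xi> \<psi>)"
  proof -
    define X where "X = {\<xi> \<in> PiE U (\<lambda>_. {1..q}). override_on \<psi> \<xi> U \<in> Hom q E}"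
    define e where "e \<xi> = restrict (override_on \<psi> \<xi> U) B" for \<xi>
    have eX: "e \<xi> \<in> EvD \<inter> HomFin q E B" if "\<xi> \<in> X" for \<xi>
      using that B by (auto simp: X_def e_def EvD_def HomFin_def Hom_def override_on_def)
    have rX: "restrict \<phi> U \<in> X" "e (restrict \<phi> U) = \<phi>" if "\<phi> \<in> EvD \<inter> HomFin q E B" for \<phi>
    proof -
      have \<phi>: "\<forall>m\<in>B. \<forall>n\<in>B. adjZ m n \<longrightarrow> E (\<phi> m) (\<phi> n)" "\<phi> \<in> PiE B (\<lambda>_. {1..q})"
        "\<forall>v\<in>bdry U. \<phi> v = \<psi> v"
        using that by (auto simp: EvD_def HomFin_def)
      let ?o = "override_on \<psi> (restrict \<phi> U) U"
      have oB: "?o k = \<phi> k" if "k \<in> B" for k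
        using that \<phi>(3) B by (auto simp: override_on_def)
      have "E (?o k) (?o (k + 1))" for k
      \<comment> \<open>An edge that meets \<open>U\<close> lies inside \<open>B\<close>, where
        \<open>\<phi>\<close> respects \<open>E\<close>; any other edge carries the values of
        \<open>\<psi>\<close>.\<close>
      proof (cases "k \<in> U \<or> k + 1 \<in> U")
        case True
        then have "k \<in> B" "k + 1 \<in> B"
          unfolding B(1) bdry_def adjZ_def by force+
        then show ?thesis using \<phi>(1) oB by (simp add: adjZ_def)
      next
        case False
        then show ?thesis using \<psi> by (auto simp: Hom_iff override_on_def)
      qed
      then show "restrict \<phi> U \<in> X" using \<phi>(2) B by (auto simp: X_def Hom_iff)
      show "e (restrict \<phi> U) = \<phi>"
        using oB \<phi>(2) by (auto simp: e_def fun_eq_iff PiE_def extensional_def)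
    qed
    have "(\<Sum>\<phi>\<in>EvD \<inter> HomFin q E B. weight lam B \<phi>) = (\<Sum>\<xi>\<in>X. weight lam B (e \<xi>))"
    proof (rule sum.reindex_bij_witness[of _ e "\<lambda>\<phi>. restrict \<phi> U"])
      fix \<xi> assume "\<xi> \<in> X"
      then show "restrict (e \<xi>) U = \<xi>"
        by (auto simp: X_def e_def B fun_eq_iff PiE_def extensional_def override_on_def)
    qed (use eX rX in auto)
    also have "\<dots> = (\<Sum>\<xi>\<in>X. (\<Prod>v\<in>bdry U. lam (\<psi> v)) * loc U \<xi> \<psi>)"
    proof (intro sum.cong refl)
      fix \<xi> assume "\<xi> \<in> X"
      have "weight lam B (e \<xi>) = (\<Prod>v\<in>U. lam (e \<xi> v)) * (\<Prod>v\<in>bdry U. lam (e \<xi> v))"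
        unfolding weight_def B(1) using U finite_bdry[OF U] B(3) by (rule prod.union_disjoint)
      also have "(\<Prod>v\<in>U. lam (e \<xi> v)) = loc U \<xi> \<psi>"
        using \<open>\<xi> \<in> X\<close> by (auto simp: loc_def X_def e_def B intro!: prod.cong)
      also have "(\<Prod>v\<in>bdry U. lam (e \<xi> v)) = (\<Prod>v\<in>bdry U. lam (\<psi> v))"
        using B by (auto simp: e_def override_on_def intro!: prod.cong)
      finally show "weight lam B (e \<xi>) = (\<Prod>v\<in>bdry U. lam (\<psi> v)) * loc U \<xi> \<psi>" by simp
    qed
    also have "\<dots> = (\<Sum>\<xi>\<in>PiE U (\<lambda>_. {1..q}). (\<Prod>v\<in>bdry U. lam (\<psi> v)) * loc U \<xi> \<psi>)"
      by (rule sum.mono_neutral_left) (auto simp: X_def loc_def U intro!: finite_PiE)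
    finally show ?thesis by (simp add: sum_distrib_left)
  qed
  also have "(\<Prod>v\<in>bdry U. lam (\<psi> v)) * loc U \<psi> \<psi> / ((\<Prod>v\<in>bdry U. lam (\<psi> v)) * (\<Sum>\<xi>\<in>PiE U (\<lambda>_. {1..q}). loc U \<xi> \<psi>))
      = loc U \<psi> \<psi> / (\<Sum>\<xi>\<in>PiE U (\<lambda>_. {1..q}). loc U \<xi> \<psi>)"
  proof -
    have "0 < (\<Prod>v\<in>bdry U. lam (\<psi> v))" using \<psi> lam_pos Hom_range by (intro prod_pos) auto
    then show ?thesis by simp
  qed
  finally show ?thesis .
qed

end

context hom_measure
begin

text \<open>The Gibbs condition evaluates the conditional probability of \<open>\<phi> 0 = j\<close> only at those \<open>\<psi>\<close> that
  satisfy \<open>\<psi> 0 = j\<close>. This gives the inequality \<open>\<le>\<close> for each \<open>j\<close>; both sides sum to the same value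
  over \<open>j\<close>, so equality holds.\<close>

lemma gibbs_single_site:
  assumes gibbs: "gibbs q E lam \<mu>" and j: "j \<in> {1..q}"
  shows "prob (cyl {-1..1} ((\<lambda>_. i)(0 := j))) * (\<Sum>l\<in>{1..q}. of_bool (E i l) * lam l) =
    of_bool (E i j) * lam j * prob (cyl {-1, 1} (\<lambda>_. i))"
proof (cases "prob (cyl {-1, 1} (\<lambda>_. i)) = 0")
  case True
  have "prob (cyl {-1..1} ((\<lambda>_. i)(0 := j))) \<le> prob (cyl {-1, 1} (\<lambda>_. i))"
    by (intro finite_measure_mono[OF _ cyl_events]) (auto simp: cyl_def)
  with True show ?thesis by (simp add: measure_le_0_iff)
next
  case False
  define A where "A = cyl {-1, 1} (\<lambda>_. i)"
  define Z where "Z = (\<Sum>l\<in>{1..q}. of_bool (E i l) * lam l)"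
  define F where "F = sigma_on q E (- {0})"
  define p where "p j = prob (cyl {-1..1} ((\<lambda>_. i)(0 := j)))" for j
  interpret F: finite_measure_subalgebra \<mu> F
    by unfold_locales (simp add: F_def subalgebra_sigma_on)
  obtain \<phi>0 where "\<phi>0 \<in> A" using False unfolding A_def by (metis ex_in_conv measure_empty)
  then have "E i (\<phi>0 0)" "\<phi>0 0 \<in> {1..q}"
    using Hom_range by (auto simp: A_def cyl_def Hom_iff dest: spec[of _ "-1"])
  then have Z: "Z > 0"
    unfolding Z_def by (intro sum_pos2[of _ "\<phi>0 0"]) (auto simp: lam_pos less_imp_le)
  have AF: "A \<in> sets F" unfolding A_def F_def by (rule cyl_in_sigma_on) auto
  have le: "p j \<le> of_bool (E i j) * lam j / Z * prob A" if j: "j \<in> {1..q}" for j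
  proof -
    define C where "C = {\<phi> \<in> space \<mu>. \<forall>v\<in>{0}. \<phi> v = j}"
    define g where "g = of_bool (E i j) * lam j / Z"
    have C: "C = cyl {0} (\<lambda>_. j)" by (auto simp: C_def cyl_def space_mu)
    have Cev [measurable]: "C \<in> events" by (simp add: C)
    have intC: "integrable \<mu> (indicator C :: _ \<Rightarrow> real)" by (simp add: emeasure_eq_measure)
    define f where "f = real_cond_exp \<mu> F (indicator C)"
    \<comment> \<open>The Gibbs value is known only on \<open>C\<close>, which need not belong to
      \<open>F\<close>. The set where the conditional probability takes that value does belong to
      \<open>F\<close>, can be integrated over, and contains almost all of
      \<open>A \<inter> C\<close>.\<close>
    define D where "D = {\<psi> \<in> space F. f \<psi> = g} \<inter> A"
    have fF: "f \<in> borel_measurable F" unfolding f_def by (rule borel_measurable_cond_exp)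
    then have DF: "D \<in> sets F"
      unfolding D_def using AF by (intro sets.Int) measurable
    then have Dev: "D \<in> events" using F.subalg by (auto simp: subalgebra_def)
    have "AE \<psi> in \<mu>. real_cond_exp \<mu> F (indicator {\<phi> \<in> space \<mu>. \<forall>v\<in>{0}. \<phi> v = \<psi> v}) \<psi> = lam_cond q E lam {0} \<psi>"
      using gibbs unfolding gibbs_def F_def by blast
    then have AE: "AE \<psi> in \<mu>. \<psi> \<in> A \<inter> C \<longrightarrow> \<psi> \<in> D"
    proof (rule AE_mp, intro AE_I2 impI)
      fix \<psi> assume \<psi>: "\<psi> \<in> A \<inter> C"
        and eq: "real_cond_exp \<mu> F (indicator {\<phi> \<in> space \<mu>. \<forall>v\<in>{0}. \<phi> v = \<psi> v}) \<psi> = lam_cond q E lam {0} \<psi>"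
      have \<psi>v: "\<psi> 0 = j" "\<psi> (-1) = i" "\<psi> 1 = i" "\<psi> \<in> Hom q E"
        using \<psi> by (auto simp: A_def C cyl_def)
      have ov: "override_on \<psi> (\<lambda>k\<in>{0}. l) {0} \<in> Hom q E \<longleftrightarrow> E i l" for l
      proof
        assume "override_on \<psi> (\<lambda>k\<in>{0}. l) {0} \<in> Hom q E"
        then have "E (override_on \<psi> (\<lambda>k\<in>{0}. l) {0} (-1)) (override_on \<psi> (\<lambda>k\<in>{0}. l) {0} (-1 + 1))"
          unfolding Hom_iff by blast
        then show "E i l" using \<psi>v by (simp add: override_on_def)
      next
        assume il: "E i l"
        have "E (override_on \<psi> (\<lambda>k\<in>{0}. l) {0} k) (override_on \<psi> (\<lambda>k\<in>{0}. l) {0} (k + 1))" for k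
        proof -
          consider "k = 0" | "k = -1" | "k \<noteq> 0" "k + 1 \<noteq> 0" by linarith
          then show ?thesis
            using il E_sym[of i l] \<psi>v by cases (auto simp: override_on_def Hom_iff)
        qed
        then show "override_on \<psi> (\<lambda>k\<in>{0}. l) {0} \<in> Hom q E" by (simp add: Hom_iff)
      qed
      have "lam_cond q E lam {0} \<psi> = lam j / (\<Sum>\<xi>\<in>PiE {0} (\<lambda>_. {1..q}). loc {0} \<xi> \<psi>)"
        using lam_cond_eq[OF \<psi>v(4), of "{0}"] loc_self[OF \<psi>v(4), of "{0}"] \<psi>v by simp
      also have "(\<Sum>\<xi>\<in>PiE {0} (\<lambda>_. {1..q}). loc {0} \<xi> \<psi>) = Z"
        unfolding sum_PiE_singleton Z_def by (simp add: loc_def ov)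
      also have "lam j / Z = g"
      proof -
        have "E (\<psi> (-1)) (\<psi> (-1 + 1))" using \<psi>v(4) unfolding Hom_iff by blast
        then show ?thesis using \<psi>v by (simp add: g_def)
      qed
      finally show "\<psi> \<in> D"
        using eq \<psi> \<psi>v unfolding D_def f_def C_def by (simp add: F_def)
    qed
    have "p j = prob (A \<inter> C)"
    proof -
      have "A = cyl {-1, 1} ((\<lambda>_. i)(0 := j))" "C = cyl {0} ((\<lambda>_. i)(0 := j))"
        by (auto simp: A_def C cyl_def)
      moreover have "{-1, 1} \<union> {0} = {-1..1::int}" by auto
      ultimately show ?thesis unfolding p_def by (simp add: cyl_Int)
    qed
    also have "\<dots> = prob (D \<inter> C)"
    proof (rule finite_measure_eq_AE)
      show "AE \<psi> in \<mu>. (\<psi> \<in> A \<inter> C) = (\<psi> \<in> D \<inter> C)"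
        using AE by eventually_elim (auto simp: D_def)
    qed (use Dev Cev in \<open>auto simp: A_def\<close>)
    also have "\<dots> = (\<integral>\<psi>\<in>D. indicator C \<psi> \<partial>\<mu>)"
      using Dev Cev by (simp add: set_lebesgue_integral_def indicator_inter_arith[symmetric])
    also have "\<dots> = (\<integral>\<psi>\<in>D. f \<psi> \<partial>\<mu>)"
      unfolding f_def by (rule F.real_cond_exp_intA[OF intC DF])
    also have "\<dots> = (\<integral>\<psi>\<in>D. g \<partial>\<mu>)"
      by (rule set_lebesgue_integral_cong[OF Dev]) (simp add: D_def)
    also have "\<dots> = g * prob D" using Dev by (simp add: set_integral_const)
    also have "\<dots> \<le> g * prob A"
      using lam_pos[OF j] Z by (intro mult_left_mono finite_measure_mono) (auto simp: D_def g_def A_def)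
    finally show ?thesis by (simp add: g_def)
  qed
  have "(\<Sum>j\<in>{1..q}. of_bool (E i j) * lam j / Z * prob A - p j) = 0"
  proof -
    have "(\<Sum>j\<in>{1..q}. of_bool (E i j) * lam j / Z * prob A) = Z / Z * prob A"
      unfolding Z_def by (simp only: sum_divide_distrib sum_distrib_right)
    moreover have "(\<Sum>j\<in>{1..q}. p j) = prob A"
    proof -
      have "insert 0 {-1, 1} = {-1..1::int}" by auto
      then show ?thesis using cyl_sum1[of 0 "{-1, 1}" "\<lambda>_. i"] by (simp add: p_def A_def)
    qed
    ultimately show ?thesis using Z by (simp add: sum_subtractf)
  qed
  then have "\<forall>j\<in>{1..q}. of_bool (E i j) * lam j / Z * prob A - p j = 0"
    by (subst (asm) sum_nonneg_eq_0_iff) (use le in auto)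
  then have "p j = of_bool (E i j) * lam j / Z * prob A" using j by auto
  then have "p j * Z = of_bool (E i j) * lam j * prob A" using Z by simp
  then show ?thesis unfolding p_def A_def Z_def .
qed

theorem reversible_gibbs_weights:
  assumes gibbs: "gibbs q E lam \<mu>" and simple: "simple q E \<mu>" and inv: "invariant q E \<mu>"
  obtains h \<rho> where "perron h \<rho>" "\<And>a b x. a \<le> b \<Longrightarrow> prob (cyl {a..b} x) = wt h \<rho> a b x"
proof -
  define pt where "pt i = prob (cyl {0} (\<lambda>_. i))" for i
  define ed where "ed i j = prob (cyl {0..1} (\<lambda>k. if k = 0 then i else j))" for i j
  have shift: "prob (cyl S (\<lambda>k. x (c + k))) = prob (cyl ((\<lambda>k. c + k) ` S) x)" for S c x
    using prob_cyl_aut[OF inv, of "\<lambda>k. c + k" S x] board_aut_iff by (auto simp: comp_def)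
  have refl: "prob (cyl S (\<lambda>k. x (c - k))) = prob (cyl ((\<lambda>k. c - k) ` S) x)" for S c x
    using prob_cyl_aut[OF inv, of "\<lambda>k. c - k" S x] board_aut_iff by (auto simp: comp_def)
  have pt: "prob (cyl {u} x) = pt (x u)" for u x
  proof -
    have "cyl {0} (\<lambda>_. x u) = cyl {0} (\<lambda>k. x (u + k))" by (rule cyl_cong) auto
    then show ?thesis unfolding pt_def using shift[of "{0}" x u] by simp
  qed
  have ed: "prob (cyl {u..u + 1} x) = ed (x u) (x (u + 1))" for u x
  proof -
    have "cyl {0..1} (\<lambda>k. if k = 0 then x u else x (u + 1)) = cyl {0..1} (\<lambda>k. x (u + k))"
    proof (rule cyl_cong)
      fix k :: int assume "k \<in> {0..1}"
      then have "k = 0 \<or> k = 1" by auto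
      then show "(if k = 0 then x u else x (u + 1)) = x (u + k)" by auto
    qed
    moreover have "(\<lambda>k. u + k) ` {0..1} = {u..u + 1}" by simp
    ultimately show ?thesis unfolding ed_def using shift[of "{0..1}" x u] by (simp only:)
  qed
  \<comment> \<open>Reflection about 1/2 exchanges the sites 0 and 1.\<close>
  have ed_sym: "ed i j = ed j i" for i j
  proof -
    let ?x = "\<lambda>k::int. if k = 0 then i else j"
    have "(\<lambda>k. 1 - k) ` {0..1::int} = {0..1}" by simp
    then have "ed i j = prob (cyl {0..1} (\<lambda>k. ?x (1 - k)))"
      unfolding ed_def using refl[of "{0..1}" ?x 1] by simp
    also have "\<dots> = ed j i" using ed[of 0 "\<lambda>k. ?x (1 - k)"] by simp
    finally show ?thesis .
  qed
  have ed0: "ed i j = 0" if "\<not> E i j" for i j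
  proof -
    have "\<phi> \<notin> cyl {0..1} (\<lambda>k. if k = 0 then i else j)" for \<phi>
    proof
      assume \<phi>: "\<phi> \<in> cyl {0..1} (\<lambda>k. if k = 0 then i else j)"
      then have "E (\<phi> 0) (\<phi> (0 + 1))" unfolding cyl_def Hom_iff by blast
      moreover have "\<phi> 0 = i" "\<phi> 1 = j" using \<phi> by (auto simp: cyl_def)
      ultimately show False using that by simp
    qed
    then have "cyl {0..1} (\<lambda>k. if k = 0 then i else j) = {}" by blast
    then show ?thesis by (simp add: ed_def)
  qed
  have pt_sum: "pt i = (\<Sum>j\<in>{1..q}. ed i j)" for i
  proof -
    have "{0..1} = insert 1 {0::int}" by auto
    then have "prob (cyl (insert 1 {0}) ((\<lambda>_. i)(1 := j))) = ed i j" for j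
      using ed[of 0 "(\<lambda>_. i)(1 := j)"] by simp
    then show ?thesis using cyl_sum1[of 1 "{0}" "\<lambda>_. i"] by (simp add: pt_def)
  qed
  have pt_total: "(\<Sum>i\<in>{1..q}. pt i) = 1"
  proof -
    have "cyl {} x = space \<mu>" for x by (auto simp: cyl_def space_mu)
    then show ?thesis using cyl_sum1[of 0 "{}" "\<lambda>_. 0"] by (simp add: pt prob_space)
  qed
  have pt0: "pt i = 0" if "i \<notin> {1..q}" for i
    using ed0[of i] E_dom(1)[of i] that by (auto simp: pt_sum intro!: sum.neutral)
  define T where "T i j = prob (cyl {-1..1} ((\<lambda>_. i)(0 := j)))" for i j
  define R where "R i = prob (cyl {-1, 1} (\<lambda>_. i))" for i
  define Z where "Z i = (\<Sum>l\<in>{1..q}. of_bool (E i l) * lam l)" for i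
  have TR: "T i j * Z i = lam j * R i" if "E i j" for i j
    using gibbs_single_site[OF gibbs, of j i] that E_dom(2)[OF that] by (simp add: T_def Z_def R_def)
  \<comment> \<open>Splitting the triple \<open>i, j, i\<close> at its centre gives
    \<open>ed i j * ed j i\<close>, a square by symmetry.\<close>
  have Ted: "T i j * pt j = (ed i j)\<^sup>2" for i j
    using simple_split[OF simple, of "-1" 0 1 "(\<lambda>_. i)(0 := j)"]
      ed[of "-1" "(\<lambda>_. i)(0 := j)"] ed[of 0 "(\<lambda>_. i)(0 := j)"] ed_sym[of i j]
    by (simp add: T_def pt power2_eq_square)
  have Zpos: "0 < Z i" if "E i j" for i j
    unfolding Z_def using that E_dom[OF that] lam_pos
    by (intro sum_pos2[of _ j]) (auto simp: less_imp_le)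
  have nonneg: "0 \<le> pt i" "0 \<le> ed i j" "0 \<le> T i j" "0 \<le> R i" for i j
    by (auto simp: pt_def ed_def T_def R_def)
  have T_le: "T i j \<le> pt j" for i j
    unfolding T_def pt_def by (intro finite_measure_mono[OF _ cyl_events]) (auto simp: cyl_def)
  have ed_ex: "\<exists>j\<in>{1..q}. ed i j \<noteq> 0" if "0 < pt i" for i
  proof (rule ccontr)
    assume "\<not> (\<exists>j\<in>{1..q}. ed i j \<noteq> 0)"
    then have "pt i = 0" unfolding pt_sum by (intro sum.neutral) blast
    then show False using that by simp
  qed
  \<comment> \<open>A positive marginal yields an edge of positive weight at \<open>i\<close>, hence
    a positive triple \<open>i, j, i\<close>, in which both neighbours equal
    \<open>i\<close>.\<close>
  have Rpos: "0 < R i" if pti: "0 < pt i" for i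
  proof -
    obtain j where j: "j \<in> {1..q}" "ed i j \<noteq> 0"
      using ed_ex[OF pti] by blast
    then have Eij: "E i j" using ed0 by blast
    have "T i j \<noteq> 0" using Ted[of i j] j by auto
    then have "T i j * Z i > 0" using Zpos[OF Eij] nonneg(3)[of i j] by simp
    then show ?thesis using TR[OF Eij] lam_pos[OF j(1)] by (simp add: zero_less_mult_iff)
  qed
  obtain i0 where i0: "i0 \<in> {1..q}" "0 < pt i0"
  proof -
    have "\<exists>i\<in>{1..q}. pt i \<noteq> 0"
      by (rule ccontr) (use pt_total in simp)
    then show ?thesis using that nonneg(1) by (metis less_eq_real_def)
  qed
  \<comment> \<open>Positivity passes along an edge from \<open>k\<close> to \<open>l\<close>:
    \<open>R k\<close> is positive, so the triple \<open>k, l, k\<close> is, and its centre is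
    \<open>l\<close>.\<close>
  have pt_pos: "0 < pt j" if j: "j \<in> {1..q}" for j
  proof (rule connected_propagate[where P="\<lambda>j. 0 < pt j", OF i0(2,1) j])
    fix k l assume kl: "E k l" "0 < pt k"
    have "0 < lam l * R k" using Rpos[OF kl(2)] lam_pos E_dom(2)[OF kl(1)] by simp
    then have "0 < T k l" using TR[OF kl(1)] Zpos[OF kl(1)] by (metis zero_less_mult_pos2)
    then show "0 < pt l" using T_le[of k l] by linarith
  qed
  define c where "c i = R i / Z i" for i
  have ed2: "(ed i j)\<^sup>2 = lam j * pt j * c i" if "E i j" for i j
  proof -
    have "T i j = lam j * c i" using TR[OF that] Zpos[OF that] by (simp add: c_def field_simps)
    then show ?thesis using Ted[of i j] by (simp add: mult_ac)
  qed
  define \<kappa> where "\<kappa> = c i0 / (lam i0 * pt i0)"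
  have c_eq: "c j = \<kappa> * (lam j * pt j)" if j: "j \<in> {1..q}" for j
  proof (rule connected_propagate[where P="\<lambda>j. c j = \<kappa> * (lam j * pt j)", OF _ i0(1) j])
    show "c i0 = \<kappa> * (lam i0 * pt i0)" using i0 lam_pos[OF i0(1)] by (simp add: \<kappa>_def)
    fix k l assume kl: "E k l" "c k = \<kappa> * (lam k * pt k)"
    have V: "k \<in> {1..q}" "l \<in> {1..q}" using E_dom[OF kl(1)] by auto
    \<comment> \<open>Two evaluations of the same squared edge weight, once from each end.\<close>
    have "lam l * pt l * c k = lam k * pt k * c l"
      using ed2[OF kl(1)] ed2[of l k] kl(1) E_sym[of k l] ed_sym[of k l] by simp
    then have "(lam k * pt k) * c l = (lam k * pt k) * (\<kappa> * (lam l * pt l))"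
      using kl(2) by (auto simp: mult_ac)
    then show "c l = \<kappa> * (lam l * pt l)"
      using lam_pos[OF V(1)] pt_pos[OF V(1)] by (metis less_irrefl mult_left_cancel mult_pos_pos)
  qed
  \<comment> \<open>Forced by the target formula: its one-site marginal is
    \<open>lam i * (h i)\<^sup>2\<close>, and its edge weights carry the factor
    \<open>1 / \<rho>\<close> where the identity for \<open>ed\<close> has
    \<open>sqrt \<kappa>\<close>.\<close>
  define h where "h i = (if i \<in> {1..q} then sqrt (pt i / lam i) else 0)" for i
  define \<rho> where "\<rho> = 1 / sqrt \<kappa>"
  obtain j0 where Ei0: "E i0 j0" using ed_ex[OF i0(2)] ed0 by blast
  have "\<kappa> > 0" unfolding \<kappa>_def c_def
    using Rpos[OF i0(2)] Zpos[OF Ei0] lam_pos[OF i0(1)] i0(2) by simp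
  then have \<rho>: "\<rho> > 0" by (simp add: \<rho>_def)
  have pt_h: "pt i = lam i * (h i)\<^sup>2" for i
    using pt0[of i] pt_pos[of i] lam_pos[of i] by (cases "i \<in> {1..q}") (auto simp: h_def)
  have h_pos: "h i > 0" if "i \<in> {1..q}" for i
    using pt_pos[OF that] lam_pos[OF that] that by (simp add: h_def)
  have ed_h: "ed i j = lam i * h i * (of_bool (E i j) * lam j * h j) / \<rho>" for i j
  proof (cases "E i j")
    case True
    have V: "i \<in> {1..q}" "j \<in> {1..q}" using E_dom[OF True] by auto
    have "(ed i j)\<^sup>2 = \<kappa> * (lam j * pt j) * (lam i * pt i)"
      using ed2[OF True] c_eq[OF V(1)] by simp
    also have "\<dots> = (lam i * h i * (lam j * h j) / \<rho>)\<^sup>2"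
      using \<open>\<kappa> > 0\<close> by (simp add: pt_h \<rho>_def power_mult_distrib) (simp add: power2_eq_square)
    finally have "ed i j = lam i * h i * (lam j * h j) / \<rho>"
      using nonneg(2)[of i j] lam_pos h_pos V \<rho>
      by (subst (asm) power2_eq_iff_nonneg) (auto simp: less_imp_le)
    then show ?thesis using True by simp
  qed (simp add: ed0)
  \<comment> \<open>Summing the edge weights over the second site returns the marginal
    \<open>pt i\<close>.\<close>
  have eig: "(\<Sum>j\<in>{1..q}. of_bool (E i j) * lam j * h j) = \<rho> * h i" if i: "i \<in> {1..q}" for i
  proof -
    have "lam i * h i / \<rho> * (\<Sum>j\<in>{1..q}. of_bool (E i j) * lam j * h j) = lam i * (h i)\<^sup>2"
      unfolding pt_h[symmetric] pt_sum sum_distrib_left by (simp add: ed_h)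
    then show ?thesis using lam_pos[OF i] h_pos[OF i] \<rho> by (simp add: field_simps power2_eq_square)
  qed
  show ?thesis
  proof (rule that)
    show "perron h \<rho>" unfolding perron_def
      using \<rho> h_pos eig pt_total by (simp add: pt_h) (simp add: h_def)
  next
    fix a b :: int and x :: "int \<Rightarrow> nat"
    assume "a \<le> b"
    then show "prob (cyl {a..b} x) = wt h \<rho> a b x"
    proof (induction b rule: int_ge_induct)
      case base
      show ?case using pt[of a x] by (simp add: wt_refl pt_h)
    next
      case (step b)
      have s: "prob (cyl {a..b + 1} x) * pt (x b) = wt h \<rho> a b x * ed (x b) (x (b + 1))"
        using simple_split[OF simple, of a b "b + 1" x] step by (simp add: pt ed)
      show ?case
      \<comment> \<open>The Markov identity determines the longer window only after division by
        \<open>pt (x b)\<close>; if \<open>x b\<close> is no node, both sides of the goal are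
        0.\<close>
      proof (cases "x b \<in> {1..q}")
        case True
        have "prob (cyl {a..b + 1} x) * pt (x b) = wt h \<rho> a (b + 1) x * h (x b) * (lam (x b) * h (x b))"
          unfolding s ed_h wt_extend_right[OF step(1)] by simp
        then show ?thesis
          using lam_pos[OF True] h_pos[OF True] by (simp add: pt_h power2_eq_square)
      next
        case False
        have "\<phi> \<notin> cyl {a..b + 1} x" for \<phi>
        proof
          assume \<phi>: "\<phi> \<in> cyl {a..b + 1} x"
          then have "\<phi> b = x b" using step(1) by (simp add: cyl_def)
          moreover have "\<phi> b \<in> {1..q}" using \<phi> by (intro Hom_range) (simp add: cyl_def)
          ultimately show False using False by simp
        qed
        then have "cyl {a..b + 1} x = {}" by blast
        moreover have "\<not> E (x b) (x (b + 1))" using False E_dom by blast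
        then have "\<not> (\<forall>k\<in>{a..<b + 1}. E (x k) (x (k + 1)))" using step(1) by force
        then have "wt h \<rho> a (b + 1) x = 0" unfolding wt_def by simp
        ultimately show ?thesis by simp
      qed
    qed
  qed
qed

end

section \<open>Gibbs property of the weights\<close>

context hom_model
begin

lemma wt_cong:
  assumes "a \<le> b" "\<And>k. k \<in> {a..b} \<Longrightarrow> x k = y k"
  shows "wt h \<rho> a b x = wt h \<rho> a b y"
proof -
  have "(\<forall>k\<in>{a..<b}. E (x k) (x (k + 1))) \<longleftrightarrow> (\<forall>k\<in>{a..<b}. E (y k) (y (k + 1)))"
    using assms(2) by auto
  moreover have "(\<Prod>k\<in>{a..b}. lam (x k)) = (\<Prod>k\<in>{a..b}. lam (y k))"
    using assms(2) by (intro prod.cong) auto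
  ultimately show ?thesis using assms by (simp add: wt_def)
qed

text \<open>The right side counts site \<open>u\<close> twice, with an extra
  \<open>lam (x u)\<close> and two interior factors \<open>h (x u)\<close>; these make up its
  single-site weight.\<close>

lemma wt_split:
  assumes "a \<le> u" "u \<le> b"
  shows "wt h \<rho> a b x * wt h \<rho> u u x = wt h \<rho> a u x * wt h \<rho> u b x"
proof -
  have "{a..<b} = {a..<u} \<union> {u..<b}" using assms by auto
  then have path: "(\<forall>k\<in>{a..<b}. E (x k) (x (k + 1))) \<longleftrightarrow>
      (\<forall>k\<in>{a..<u}. E (x k) (x (k + 1))) \<and> (\<forall>k\<in>{u..<b}. E (x k) (x (k + 1)))" by blast
  have "{a..b} = {a..u} \<union> {u<..b}" "{u..b} = insert u {u<..b}" "{a..u} \<inter> {u<..b} = {}"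
    using assms by auto
  then have prods: "(\<Prod>k\<in>{a..b}. lam (x k)) * lam (x u) = (\<Prod>k\<in>{a..u}. lam (x k)) * (\<Prod>k\<in>{u..b}. lam (x k))"
    by (simp add: prod.union_disjoint)
  have "nat (b - a) = nat (u - a) + nat (b - u)" using assms by simp
  then have pw: "\<rho> ^ nat (b - a) = \<rho> ^ nat (u - a) * \<rho> ^ nat (b - u)" by (simp add: power_add)
  show ?thesis
  proof (cases "\<forall>k\<in>{a..<b}. E (x k) (x (k + 1))")
    case True
    have "wt h \<rho> a b x * wt h \<rho> u u x = h (x a) * h (x b) * (h (x u))\<^sup>2 *
        ((\<Prod>k\<in>{a..b}. lam (x k)) * lam (x u)) / \<rho> ^ nat (b - a)"
      using True unfolding wt_refl wt_def by simp
    also have "\<dots> = wt h \<rho> a u x * wt h \<rho> u b x"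
      using True path unfolding prods pw wt_def by (simp add: power2_eq_square)
    finally show ?thesis .
  next
    case False
    then show ?thesis using path by (auto simp: wt_def)
  qed
qed

lemma wt_shift: "wt h \<rho> (c + a) (c + b) (\<lambda>k. x (k - c)) = wt h \<rho> a b x"
proof -
  have "(\<forall>k\<in>{c + a..<c + b}. E (x (k - c)) (x (k + 1 - c))) \<longleftrightarrow> (\<forall>k\<in>{a..<b}. E (x k) (x (k + 1)))"
  proof (intro iffI ballI)
    fix k assume *: "\<forall>k\<in>{c + a..<c + b}. E (x (k - c)) (x (k + 1 - c))" "k \<in> {a..<b}"
    then show "E (x k) (x (k + 1))" using bspec[OF *(1), of "c + k"] by (simp add: algebra_simps)
  next
    fix k assume *: "\<forall>k\<in>{a..<b}. E (x k) (x (k + 1))" "k \<in> {c + a..<c + b}"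
    then show "E (x (k - c)) (x (k + 1 - c))" using bspec[OF *(1), of "k - c"] by (simp add: algebra_simps)
  qed
  moreover have "(\<Prod>k\<in>{c + a..c + b}. lam (x (k - c))) = (\<Prod>k\<in>{a..b}. lam (x k))"
    by (rule prod.reindex_bij_witness[of _ "\<lambda>k. c + k" "\<lambda>k. k - c"]) auto
  ultimately show ?thesis by (simp add: wt_def)
qed

text \<open>The formula treats its two ends alike and \<open>E\<close> is symmetric: this is the
  reversibility of the chain.\<close>

lemma wt_reflect: "wt h \<rho> (c - b) (c - a) (\<lambda>k. x (c - k)) = wt h \<rho> a b x"
proof -
  have "(\<forall>k\<in>{c - b..<c - a}. E (x (c - k)) (x (c - (k + 1)))) \<longleftrightarrow> (\<forall>k\<in>{a..<b}. E (x k) (x (k + 1)))"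
  proof (intro iffI ballI)
    fix k assume *: "\<forall>k\<in>{c - b..<c - a}. E (x (c - k)) (x (c - (k + 1)))" "k \<in> {a..<b}"
    then show "E (x k) (x (k + 1))"
      using bspec[OF *(1), of "c - k - 1"] E_sym[of "x k"] by (simp add: algebra_simps)
  next
    fix k assume *: "\<forall>k\<in>{a..<b}. E (x k) (x (k + 1))" "k \<in> {c - b..<c - a}"
    then show "E (x (c - k)) (x (c - (k + 1)))"
      using bspec[OF *(1), of "c - k - 1"] E_sym[of "x (c - k)"] by (simp add: algebra_simps)
  qed
  moreover have "(\<Prod>k\<in>{c - b..c - a}. lam (x (c - k))) = (\<Prod>k\<in>{a..b}. lam (x k))"
    by (rule prod.reindex_bij_witness[of _ "\<lambda>k. c - k" "\<lambda>k. c - k"]) auto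
  ultimately show ?thesis by (simp add: wt_def)
qed

text \<open>The strict inclusion matters: every edge that meets \<open>U\<close> must have both ends
  in the closed window.\<close>

lemma edge_outside:
  fixes U :: "int set"
  assumes "U \<subseteq> {-n<..<n}" "k \<notin> {-n..<n}"
  shows "k \<notin> U" "k + 1 \<notin> U"
  using subsetD[OF assms(1), of k] subsetD[OF assms(1), of "k + 1"] assms(2) by auto

lemma override_Hom_iff:
  assumes \<psi>: "\<psi> \<in> Hom q E" and U: "U \<subseteq> {-n<..<n}"
  shows "override_on \<psi> \<xi> U \<in> Hom q E \<longleftrightarrow>
    (\<forall>k\<in>{-n..<n}. E (override_on \<psi> \<xi> U k) (override_on \<psi> \<xi> U (k + 1)))"
proof
  assume *: "\<forall>k\<in>{-n..<n}. E (override_on \<psi> \<xi> U k) (override_on \<psi> \<xi> U (k + 1))"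
  have "E (override_on \<psi> \<xi> U k) (override_on \<psi> \<xi> U (k + 1))" for k
  proof (cases "k \<in> {-n..<n}")
    case False
    then show ?thesis using edge_outside[OF U False] \<psi> by (simp add: Hom_iff)
  qed (use * in blast)
  then show "override_on \<psi> \<xi> U \<in> Hom q E" by (simp add: Hom_iff)
qed (simp add: Hom_iff)

text \<open>Consequently the candidate conditional probability is constant on each cylinder over a
  large window off \<open>U\<close>.\<close>

lemma loc_cong:
  assumes "\<psi> \<in> Hom q E" "\<psi>' \<in> Hom q E" and U: "U \<subseteq> {-n<..<n}"
    and eq: "\<And>k. k \<in> - U \<inter> {-n..n} \<Longrightarrow> \<psi> k = \<psi>' k"
  shows "loc U \<xi> \<psi> = loc U \<xi> \<psi>'"
proof -
  have "override_on \<psi> \<xi> U k = override_on \<psi>' \<xi> U k" if "k \<in> {-n..n}" for k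
    using eq[of k] that by (cases "k \<in> U") auto
  then have "override_on \<psi> \<xi> U \<in> Hom q E \<longleftrightarrow> override_on \<psi>' \<xi> U \<in> Hom q E"
    unfolding override_Hom_iff[OF assms(1) U] override_Hom_iff[OF assms(2) U] by auto
  then show ?thesis by (simp add: loc_def)
qed

text \<open>The endpoints lie outside \<open>U\<close>, so both factors \<open>h\<close> depend on
  \<open>\<psi>\<close> alone and \<open>\<xi>\<close> enters only through
  \<open>loc\<close>.\<close>

lemma wt_override:
  assumes \<psi>: "\<psi> \<in> Hom q E" and U: "U \<subseteq> {-n<..<n}" and n: "0 \<le> n"
  shows "wt h \<rho> (-n) n (override_on \<psi> \<xi> U) =
    h (\<psi> (-n)) * h (\<psi> n) * (\<Prod>k\<in>-U \<inter> {-n..n}. lam (\<psi> k)) / \<rho> ^ nat (2 * n) * loc U \<xi> \<psi>"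
proof -
  have finU: "finite U" using finite_subset[OF U] by auto
  have ends: "-n \<notin> U" "n \<notin> U" using U by auto
  have "{-n..n} = U \<union> (- U \<inter> {-n..n})" using U by auto
  then have "(\<Prod>k\<in>{-n..n}. lam (override_on \<psi> \<xi> U k)) =
      (\<Prod>k\<in>U. lam (override_on \<psi> \<xi> U k)) * (\<Prod>k\<in>-U \<inter> {-n..n}. lam (override_on \<psi> \<xi> U k))"
    using finU by (metis (no_types, lifting) Compl_disjoint finite_Int finite_atLeastAtMost_int inf_assoc inf_bot_left prod.union_disjoint)
  also have "\<dots> = (\<Prod>k\<in>U. lam (\<xi> k)) * (\<Prod>k\<in>-U \<inter> {-n..n}. lam (\<psi> k))"
    by (intro arg_cong2[where f="(*)"] prod.cong) auto
  finally have prods: "(\<Prod>k\<in>{-n..n}. lam (override_on \<psi> \<xi> U k)) =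
      (\<Prod>k\<in>U. lam (\<xi> k)) * (\<Prod>k\<in>-U \<inter> {-n..n}. lam (\<psi> k))" .
  show ?thesis
    unfolding wt_def prods loc_def override_Hom_iff[OF \<psi> U] using ends by (simp add: mult_ac)
qed

lemma loc_measurable:
  "(\<lambda>\<psi>. loc U \<xi> \<psi>) \<in> borel_measurable (sigma_on q E (- U))"
proof -
  have "(\<lambda>\<psi>. override_on \<psi> \<xi> U k) \<in> measurable (sigma_on q E (- U)) (count_space UNIV)" for k
  proof (cases "k \<in> U")
    case False
    then show ?thesis using measurable_sigma_on[of k "- U"] by simp
  qed simp
  from pred_in_Hom[of "\<lambda>\<psi>. override_on \<psi> \<xi> U", OF this]
  have [measurable]: "Measurable.pred (sigma_on q E (- U)) (\<lambda>\<psi>. override_on \<psi> \<xi> U \<in> Hom q E)" .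
  show ?thesis unfolding loc_def by measurable
qed

end

text \<open>Equality of set integrals thereby becomes equality of two measures, which can be checked
  on a pi-system.\<close>

lemma (in finite_measure) set_integral_eq_density:
  assumes [measurable]: "f \<in> borel_measurable M" "A \<in> sets M" and "\<And>x. 0 \<le> f x"
  shows "(\<integral>x\<in>A. f x \<partial>M) = enn2real (emeasure (density M (\<lambda>x. ennreal (f x))) A)"
proof -
  have "(\<integral>x\<in>A. f x \<partial>M) = enn2real (\<integral>\<^sup>+x. ennreal (indicator A x *\<^sub>R f x) \<partial>M)"
    unfolding set_lebesgue_integral_def using assms by (intro integral_eq_nn_integral) auto
  also have "(\<integral>\<^sup>+x. ennreal (indicator A x *\<^sub>R f x) \<partial>M) = emeasure (density M (\<lambda>x. ennreal (f x))) A"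
    by (subst emeasure_density) (auto intro!: nn_integral_cong simp: indicator_def)
  finally show ?thesis .
qed

section \<open>Simplicity, invariance and the Gibbs property from the window formula\<close>

locale markov_measure = hom_measure +
  fixes h :: "nat \<Rightarrow> real" and \<rho> :: real
  assumes prob_cyl: "\<And>a b x. a \<le> b \<Longrightarrow> prob (cyl {a..b} x) = wt h \<rho> a b x"
begin

lemma simple: "simple q E \<mu>"
proof (rule simpleI)
  fix a u b :: int and x assume "a \<le> u" "u \<le> b"
  then show "prob (cyl {a..b} x) * prob (cyl {u} x) = prob (cyl {a..u} x) * prob (cyl {u..b} x)"
    using wt_split prob_cyl[of u u x] by (simp add: prob_cyl)
qed

lemma invariant: "invariant q E \<mu>"
  unfolding invariant_def
proof (intro allI impI)
  fix \<alpha> assume \<alpha>: "board_aut \<alpha>"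
  have meas: "(\<lambda>\<phi>. \<phi> \<circ> \<alpha>) \<in> measurable \<mu> (HomM q E)"
    using measurable_comp_HomM[OF \<alpha>] measurable_cong_sets[OF sets_mu refl] by blast
  show "distr \<mu> (HomM q E) (\<lambda>\<phi>. \<phi> \<circ> \<alpha>) = \<mu>"
  proof (rule measure_eqI_cyl[where S=UNIV and ?n0.0=0])
    show "finite_measure (distr \<mu> (HomM q E) (\<lambda>\<phi>. \<phi> \<circ> \<alpha>))"
      by (rule finite_measure_distr[OF meas])
    fix n :: int and x assume n: "0 \<le> n"
    have "emeasure (distr \<mu> (HomM q E) (\<lambda>\<phi>. \<phi> \<circ> \<alpha>)) (cyl {-n..n} x) =
        prob ((\<lambda>\<phi>. \<phi> \<circ> \<alpha>) -` cyl {-n..n} x \<inter> space \<mu>)"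
      using emeasure_distr[OF meas cyl_sets] by (simp add: emeasure_eq_measure)
    also have "prob ((\<lambda>\<phi>. \<phi> \<circ> \<alpha>) -` cyl {-n..n} x \<inter> space \<mu>) = prob (cyl {-n..n} x)"
    proof -
      consider c where "\<alpha> = (\<lambda>k. c + k)" | c where "\<alpha> = (\<lambda>k. c - k)"
        using \<alpha> board_aut_iff by blast
      then show ?thesis
      proof cases
        case 1
        have "(\<lambda>\<phi>. \<phi> \<circ> \<alpha>) -` cyl {-n..n} x \<inter> space \<mu> = cyl {c + -n..c + n} (\<lambda>k. x (k - c))"
        proof (intro set_eqI iffI)
          fix \<phi> assume \<phi>: "\<phi> \<in> (\<lambda>\<phi>. \<phi> \<circ> \<alpha>) -` cyl {-n..n} x \<inter> space \<mu>"
          then have *: "\<forall>k\<in>{-n..n}. \<phi> (c + k) = x k" "\<phi> \<in> Hom q E" by (auto simp: cyl_def space_mu 1)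
          have "\<phi> k = x (k - c)" if "k \<in> {c + -n..c + n}" for k
            using bspec[OF *(1), of "k - c"] that by simp
          then show "\<phi> \<in> cyl {c + -n..c + n} (\<lambda>k. x (k - c))" using * by (simp add: cyl_def)
        qed (use comp_Hom[OF \<alpha>] in \<open>auto simp: cyl_def space_mu 1\<close>)
        then show ?thesis using n by (simp only: prob_cyl wt_shift)
      next
        case 2
        have "(\<lambda>\<phi>. \<phi> \<circ> \<alpha>) -` cyl {-n..n} x \<inter> space \<mu> = cyl {c - n..c - -n} (\<lambda>k. x (c - k))"
        proof (intro set_eqI iffI)
          fix \<phi> assume \<phi>: "\<phi> \<in> (\<lambda>\<phi>. \<phi> \<circ> \<alpha>) -` cyl {-n..n} x \<inter> space \<mu>"
          then have *: "\<forall>k\<in>{-n..n}. \<phi> (c - k) = x k" "\<phi> \<in> Hom q E" by (auto simp: cyl_def space_mu 2)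
          have "\<phi> k = x (c - k)" if "k \<in> {c - n..c - -n}" for k
            using bspec[OF *(1), of "c - k"] that by simp
          then show "\<phi> \<in> cyl {c - n..c - -n} (\<lambda>k. x (c - k))" using * by (simp add: cyl_def)
        qed (use comp_Hom[OF \<alpha>] in \<open>auto simp: cyl_def space_mu 2\<close>)
        then show ?thesis using n by (simp only: prob_cyl wt_reflect)
      qed
    qed
    finally show "emeasure (distr \<mu> (HomM q E) (\<lambda>\<phi>. \<phi> \<circ> \<alpha>)) (cyl (UNIV \<inter> {-n..n}) x) =
        emeasure \<mu> (cyl (UNIV \<inter> {-n..n}) x)"
      unfolding Int_UNIV_left emeasure_eq_measure .
  qed (simp_all add: sets_sigma_on_UNIV sets_mu)
qed

text \<open>The weight of a window splits into a factor that only sees the configuration off \<open>U\<close>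
  and the factor \<open>loc\<close>; this is the Gibbs property on cylinders.\<close>

lemma prob_cyl_loc:
  assumes \<psi>: "\<psi> \<in> Hom q E" and U: "U \<subseteq> {-n<..<n}" and n: "0 \<le> n" and \<xi>: "\<xi> \<in> PiE U (\<lambda>_. {1..q})"
  shows "prob (cyl (-U \<inter> {-n..n}) \<psi> \<inter> cyl U \<xi>) =
    loc U \<xi> \<psi> / (\<Sum>\<xi>\<in>PiE U (\<lambda>_. {1..q}). loc U \<xi> \<psi>) * prob (cyl (-U \<inter> {-n..n}) \<psi>)"
proof -
  have finU: "finite U" using finite_subset[OF U] by auto
  have un: "(-U \<inter> {-n..n}) \<union> U = {-n..n}" using U by auto
  define K where "K = h (\<psi> (-n)) * h (\<psi> n) * (\<Prod>k\<in>-U \<inter> {-n..n}. lam (\<psi> k)) / \<rho> ^ nat (2 * n)"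
  have w: "prob (cyl {-n..n} (override_on \<psi> \<xi> U)) = K * loc U \<xi> \<psi>" for \<xi>
    using prob_cyl[of "-n" n] wt_override[OF \<psi> U n] n by (simp add: K_def)
  have "cyl (-U \<inter> {-n..n}) \<psi> = cyl (-U \<inter> {-n..n}) (override_on \<psi> \<xi> U)" "cyl U \<xi> = cyl U (override_on \<psi> \<xi> U)"
    by (auto simp: cyl_def)
  then have "prob (cyl (-U \<inter> {-n..n}) \<psi> \<inter> cyl U \<xi>) = K * loc U \<xi> \<psi>"
    by (simp only: cyl_Int un w)
  moreover have "prob (cyl (-U \<inter> {-n..n}) \<psi>) = K * (\<Sum>\<xi>\<in>PiE U (\<lambda>_. {1..q}). loc U \<xi> \<psi>)"
    using cyl_sum[of "-U \<inter> {-n..n}" U \<psi>] finU by (simp add: un w sum_distrib_left Int_commute Int_left_commute)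
  ultimately show ?thesis using sum_loc_pos[OF \<psi> finU] by simp
qed

text \<open>The event in the Gibbs condition varies with \<open>\<psi>\<close>. The conditional
  probability of each fixed \<open>\<xi>\<close> on \<open>U\<close> is therefore identified first;
  there are finitely many, so almost surely all identities hold at once, and the one for the
  restriction of \<open>\<psi>\<close> is selected.\<close>

lemma gibbs: "gibbs q E lam \<mu>"
  unfolding gibbs_def
proof (intro conjI allI impI \<mu>)
  fix U :: "int set" assume finU: "finite U"
  define \<Xi> where "\<Xi> = PiE U (\<lambda>_. {1..q})"
  have fin\<Xi>: "finite \<Xi>" unfolding \<Xi>_def using finU by (intro finite_PiE) auto
  define F where "F = sigma_on q E (- U)"
  have F: "subalgebra \<mu> F" unfolding F_def by (rule subalgebra_sigma_on)
  interpret F: finite_measure_subalgebra \<mu> F by unfold_locales (rule F)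
  define g where "g \<xi> \<psi> = (if \<psi> \<in> Hom q E then loc U \<xi> \<psi> / (\<Sum>\<xi>\<in>\<Xi>. loc U \<xi> \<psi>) else 0)" for \<xi> \<psi>
  obtain N :: int where N: "U \<subseteq> {-N<..<N}" "0 \<le> N"
  proof
    show "U \<subseteq> {-(Max ((\<lambda>k. \<bar>k\<bar>) ` insert 0 U) + 1)<..<Max ((\<lambda>k. \<bar>k\<bar>) ` insert 0 U) + 1}"
    proof
      fix k assume "k \<in> U"
      then have "\<bar>k\<bar> \<le> Max ((\<lambda>k. \<bar>k\<bar>) ` insert 0 U)" using finU by (intro Max_ge) auto
      then show "k \<in> {-(Max ((\<lambda>k. \<bar>k\<bar>) ` insert 0 U) + 1)<..<Max ((\<lambda>k. \<bar>k\<bar>) ` insert 0 U) + 1}" by auto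
    qed
    have "\<bar>0\<bar> \<le> Max ((\<lambda>k::int. \<bar>k\<bar>) ` insert 0 U)" using finU by (intro Max_ge) auto
    then show "0 \<le> Max ((\<lambda>k. \<bar>k\<bar>) ` insert 0 U) + 1" by simp
  qed
  have g01: "0 \<le> g \<xi> \<psi>" "g \<xi> \<psi> \<le> 1" if \<xi>: "\<xi> \<in> \<Xi>" for \<xi> \<psi>
  proof -
    have "loc U \<xi> \<psi> \<le> (\<Sum>\<xi>\<in>\<Xi>. loc U \<xi> \<psi>)"
      by (rule member_le_sum[OF \<xi> _ fin\<Xi>]) (simp add: loc_nonneg \<Xi>_def)
    moreover have "0 < (\<Sum>\<xi>\<in>\<Xi>. loc U \<xi> \<psi>)" if "\<psi> \<in> Hom q E"
      unfolding \<Xi>_def using that finU by (rule sum_loc_pos)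
    ultimately show "0 \<le> g \<xi> \<psi>" "g \<xi> \<psi> \<le> 1"
      using loc_nonneg[of \<xi> U \<psi>] \<xi> by (auto simp: g_def \<Xi>_def)
  qed
  have gF: "g \<xi> \<in> borel_measurable F" for \<xi>
  proof -
    have [measurable]: "(\<lambda>\<psi>. loc U \<xi> \<psi>) \<in> borel_measurable F" for \<xi>
      unfolding F_def by (rule loc_measurable)
    have "(\<lambda>\<psi>. loc U \<xi> \<psi> / (\<Sum>\<xi>\<in>\<Xi>. loc U \<xi> \<psi>)) \<in> borel_measurable F" by measurable
    then show ?thesis
      by (rule measurable_cong[THEN iffD1, rotated]) (simp add: g_def F_def)
  qed
  have "AE \<psi> in \<mu>. real_cond_exp \<mu> F (indicator (cyl U \<xi>)) \<psi> = g \<xi> \<psi>" if \<xi>: "\<xi> \<in> \<Xi>" for \<xi>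
  proof (rule F.real_cond_exp_charact)
    have gM [measurable]: "g \<xi> \<in> borel_measurable \<mu>" using measurable_from_subalg[OF F gF] .
    have iM [measurable]: "(indicator (cyl U \<xi>) :: _ \<Rightarrow> real) \<in> borel_measurable \<mu>"
      by (rule borel_measurable_indicator[OF cyl_events])
    show "integrable \<mu> (indicator (cyl U \<xi>) :: _ \<Rightarrow> real)" by (simp add: emeasure_eq_measure)
    show "integrable \<mu> (g \<xi>)"
      using g01[OF \<xi>] by (intro integrable_const_bound[where B=1]) auto
    show "g \<xi> \<in> borel_measurable F" by (rule gF)
    \<comment> \<open>Both sides of the characterisation of conditional expectation become measures
      on \<open>F\<close>, to be compared on cylinders over windows off \<open>U\<close>.\<close>
    let ?D1 = "density \<mu> (\<lambda>\<psi>. ennreal (indicator (cyl U \<xi>) \<psi>))"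
    let ?D2 = "density \<mu> (\<lambda>\<psi>. ennreal (g \<xi> \<psi>))"
    have sub: "subalgebra ?D1 F" "subalgebra ?D2 F" using F by (auto simp: subalgebra_def)
    have D1: "emeasure ?D1 A = prob (A \<inter> cyl U \<xi>)" if "A \<in> events" for A
    proof -
      have "emeasure ?D1 A = (\<integral>\<^sup>+\<psi>. indicator (A \<inter> cyl U \<xi>) \<psi> \<partial>\<mu>)"
        using that by (subst emeasure_density) (auto intro!: nn_integral_cong split: split_indicator)
      then show ?thesis
        using nn_integral_indicator[OF sets.Int[OF that cyl_events]] by (simp add: emeasure_eq_measure)
    qed
    have "restr_to_subalg ?D1 F = restr_to_subalg ?D2 F"
    proof (rule measure_eqI_cyl[where S="- U" and ?n0.0=N])
      show "sets (restr_to_subalg ?D1 F) = sets (sigma_on q E (- U))"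
        "sets (restr_to_subalg ?D2 F) = sets (sigma_on q E (- U))"
        using sets_restr_to_subalg[OF sub(1)] sets_restr_to_subalg[OF sub(2)] by (simp_all add: F_def)
      show "finite_measure (restr_to_subalg ?D1 F)"
      proof
        have "emeasure (restr_to_subalg ?D1 F) (space F) = emeasure ?D1 (space F)"
          by (rule emeasure_restr_to_subalg[OF sub(1)]) simp
        also have "\<dots> = prob (space \<mu> \<inter> cyl U \<xi>)" using F D1[of "space \<mu>"] by (simp add: subalgebra_def)
        finally show "emeasure (restr_to_subalg ?D1 F) (space (restr_to_subalg ?D1 F)) \<noteq> \<infinity>"
          using F by (simp add: space_restr_to_subalg subalgebra_def)
      qed
      fix n x assume n: "N \<le> n"
      define A where "A = cyl (- U \<inter> {-n..n}) x"
      have AF: "A \<in> sets F" unfolding A_def F_def by (rule cyl_in_sigma_on) auto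
      have Aev: "A \<in> events" by (simp add: A_def)
      have "emeasure ?D1 A = emeasure ?D2 A"
      proof (cases "A = {}")
        case False
        then obtain \<psi> where \<psi>: "\<psi> \<in> A" by blast
        then have \<psi>H: "\<psi> \<in> Hom q E" and A\<psi>: "A = cyl (- U \<inter> {-n..n}) \<psi>"
          by (auto simp: A_def cyl_def)
        have Un: "U \<subseteq> {-n<..<n}" "0 \<le> n" using N n by auto
        \<comment> \<open>On \<open>A\<close> the function \<open>g \<xi>\<close> is a constant, so
          its integral is a product and \<open>prob_cyl_loc\<close> applies.\<close>
        have g_const: "g \<xi> \<phi> = g \<xi> \<psi>" if "\<phi> \<in> A" for \<phi>
        proof -
          have \<phi>: "\<phi> \<in> Hom q E" "\<And>k. k \<in> - U \<inter> {-n..n} \<Longrightarrow> \<phi> k = \<psi> k"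
            using that unfolding A\<psi> cyl_def by auto
          have "loc U \<xi> \<phi> = loc U \<xi> \<psi>" for \<xi>
            using loc_cong[OF \<phi>(1) \<psi>H Un(1) \<phi>(2)] .
          then show ?thesis using \<phi>(1) \<psi>H by (simp add: g_def)
        qed
        have "emeasure ?D2 A = (\<integral>\<^sup>+\<phi>. ennreal (g \<xi> \<psi>) * indicator A \<phi> \<partial>\<mu>)"
          using Aev by (subst emeasure_density) (auto intro!: nn_integral_cong simp: indicator_def g_const)
        also have "\<dots> = ennreal (g \<xi> \<psi> * prob A)"
          using Aev g01[OF \<xi>] by (simp add: nn_integral_cmult_indicator emeasure_eq_measure ennreal_mult)
        also have "g \<xi> \<psi> * prob A = prob (A \<inter> cyl U \<xi>)"
          using prob_cyl_loc[OF \<psi>H Un, of \<xi>] \<xi> \<psi>H unfolding A\<psi> by (simp add: g_def \<Xi>_def)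
        finally show ?thesis using D1[OF Aev] by simp
      qed simp
      then show "emeasure (restr_to_subalg ?D1 F) (cyl (- U \<inter> {-n..n}) x) =
          emeasure (restr_to_subalg ?D2 F) (cyl (- U \<inter> {-n..n}) x)"
        using emeasure_restr_to_subalg[OF sub(1) AF] emeasure_restr_to_subalg[OF sub(2) AF]
        by (simp add: A_def)
    qed
    then have D12: "emeasure ?D1 A = emeasure ?D2 A" if "A \<in> sets F" for A
      using emeasure_restr_to_subalg[OF sub(1) that] emeasure_restr_to_subalg[OF sub(2) that] by simp
    fix A assume A: "A \<in> sets F"
    then have Aev: "A \<in> events" using F by (auto simp: subalgebra_def)
    show "(\<integral>\<psi>\<in>A. indicator (cyl U \<xi>) \<psi> \<partial>\<mu>) = (\<integral>\<psi>\<in>A. g \<xi> \<psi> \<partial>\<mu>)"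
      using set_integral_eq_density[of "indicator (cyl U \<xi>)" A] set_integral_eq_density[of "g \<xi>" A]
        iM Aev D12[OF A] g01(1)[OF \<xi>] by simp
  qed
  then have "AE \<psi> in \<mu>. \<forall>\<xi>\<in>\<Xi>. real_cond_exp \<mu> F (indicator (cyl U \<xi>)) \<psi> = g \<xi> \<psi>"
    by (intro AE_finite_allI fin\<Xi>)
  then show "AE \<psi> in \<mu>. real_cond_exp \<mu> (sigma_on q E (- U))
      (indicator {\<phi> \<in> space \<mu>. \<forall>v\<in>U. \<phi> v = \<psi> v}) \<psi> = lam_cond q E lam U \<psi>"
  proof (rule AE_mp, intro AE_I2 impI)
    fix \<psi> assume "\<psi> \<in> space \<mu>"
      and *: "\<forall>\<xi>\<in>\<Xi>. real_cond_exp \<mu> F (indicator (cyl U \<xi>)) \<psi> = g \<xi> \<psi>"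
    then have \<psi>: "\<psi> \<in> Hom q E" by (simp add: space_mu)
    have r: "restrict \<psi> U \<in> \<Xi>" using Hom_range[OF \<psi>] by (auto simp: \<Xi>_def)
    have "{\<phi> \<in> space \<mu>. \<forall>v\<in>U. \<phi> v = \<psi> v} = cyl U (restrict \<psi> U)"
      by (auto simp: cyl_def space_mu)
    moreover have "override_on \<psi> (restrict \<psi> U) U = override_on \<psi> \<psi> U" by (auto simp: override_on_def)
    then have "g (restrict \<psi> U) \<psi> = lam_cond q E lam U \<psi>"
      using \<psi> lam_cond_eq[OF \<psi> finU] by (simp add: g_def loc_def \<Xi>_def)
    ultimately show "real_cond_exp \<mu> (sigma_on q E (- U))
        (indicator {\<phi> \<in> space \<mu>. \<forall>v\<in>U. \<phi> v = \<psi> v}) \<psi> = lam_cond q E lam U \<psi>"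
      using * r by (simp add: F_def)
  qed
qed

end

section \<open>Construction of the chain\<close>

text \<open>The two-sided chain is driven by independent random maps: \<open>\<omega> (k, i)\<close> is the state
  entered at site \<open>k\<close> when the neighbouring site closer to the origin has state \<open>i\<close>, and
  \<open>\<omega> (0, 0)\<close> is the initial state; \<open>pred_state x k\<close> is that neighbouring state, with the
  dummy value 0 at the origin.\<close>

primrec walk :: "int \<Rightarrow> (int \<times> nat \<Rightarrow> nat) \<Rightarrow> nat \<Rightarrow> nat" where
  "walk s \<omega> 0 = \<omega> (0, 0)"
| "walk s \<omega> (Suc n) = \<omega> (s * int (Suc n), walk s \<omega> n)"

definition path :: "(int \<times> nat \<Rightarrow> nat) \<Rightarrow> int \<Rightarrow> nat" where
  "path \<omega> k = walk (sgn k) \<omega> (nat \<bar>k\<bar>)"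

definition pred_state :: "(int \<Rightarrow> nat) \<Rightarrow> int \<Rightarrow> nat" where
  "pred_state x k = (if k = 0 then 0 else x (k - sgn k))"

lemma path_rec: "path \<omega> k = \<omega> (k, pred_state (path \<omega>) k)"
proof (cases "k = 0")
  case True
  then show ?thesis by (simp add: path_def pred_state_def)
next
  case False
  then obtain m where m: "nat \<bar>k\<bar> = Suc m" by (cases "nat \<bar>k\<bar>") auto
  have k: "sgn k * int (Suc m) = k" using m False by (cases "k > 0") (auto simp: sgn_if)
  have "nat \<bar>k - sgn k\<bar> = m" using m False by (cases "k > 0") (auto simp: sgn_if)
  moreover have "walk (sgn (k - sgn k)) \<omega> m = walk (sgn k) \<omega> m"
  proof (cases m)
    case (Suc n)
    then have "sgn (k - sgn k) = sgn k" using m by (cases "k > 0") (auto simp: sgn_if)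
    then show ?thesis by simp
  qed simp
  ultimately have "path \<omega> (k - sgn k) = walk (sgn k) \<omega> m" by (simp add: path_def)
  then show ?thesis using False k by (simp add: path_def m pred_state_def)
qed

lemma pred_site_mem:
  fixes k n :: int
  shows "k \<in> {-n..n} \<Longrightarrow> k \<noteq> 0 \<Longrightarrow> k - sgn k \<in> {-n..n}"
  by (cases "k > 0") (auto simp: sgn_if)

text \<open>Induction outward from the origin: once the path agrees with \<open>x\<close> up to the
  preceding site, the coordinate read next is the one indexed by \<open>x\<close>. A window event
  thus fixes one predetermined coordinate per site.\<close>

lemma path_eq_on_iff:
  "(\<forall>k\<in>{-n..n}. path \<omega> k = x k) \<longleftrightarrow> (\<forall>k\<in>{-n..n}. \<omega> (k, pred_state x k) = x k)"
proof
  assume *: "\<forall>k\<in>{-n..n}. path \<omega> k = x k"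
  show "\<forall>k\<in>{-n..n}. \<omega> (k, pred_state x k) = x k"
  proof
    fix k assume k: "k \<in> {-n..n}"
    have "pred_state x k = pred_state (path \<omega>) k"
      using * pred_site_mem[OF k] by (simp add: pred_state_def)
    then show "\<omega> (k, pred_state x k) = x k" using * k path_rec[of \<omega> k] by simp
  qed
next
  assume *: "\<forall>k\<in>{-n..n}. \<omega> (k, pred_state x k) = x k"
  have "path \<omega> k = x k" if "k \<in> {-n..n}" for k
    using that
  proof (induction "nat \<bar>k\<bar>" arbitrary: k)
    case 0
    then have "k = 0" by simp
    then show ?case using bspec[OF * 0(2)] path_rec[of \<omega> k] by (simp add: pred_state_def)
  next
    case (Suc m)
    then have "k \<noteq> 0" by auto
    moreover have "nat \<bar>k - sgn k\<bar> = m" using Suc(2) by (cases "k > 0") (auto simp: sgn_if)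
    ultimately have "pred_state (path \<omega>) k = pred_state x k"
      using Suc(1)[of "k - sgn k"] pred_site_mem[OF Suc(3)] by (simp add: pred_state_def)
    then show ?case using * Suc(3) path_rec[of \<omega> k] by simp
  qed
  then show "\<forall>k\<in>{-n..n}. path \<omega> k = x k" by blast
qed

locale perron_walk = hom_model +
  fixes h :: "nat \<Rightarrow> real" and \<rho> :: real
  assumes perron: "perron h \<rho>"
begin

text \<open>For a node \<open>i\<close> this is the Doob transform by \<open>h\<close> of the matrix
  \<open>E i j * lam j\<close>. The other rows hold the stationary law, so that the dummy state 0
  makes the initial draw an ordinary transition.\<close>

definition tr :: "nat \<Rightarrow> nat \<Rightarrow> real" where
  "tr i j = (if i \<in> {1..q} then of_bool (E i j) * lam j * h j / (\<rho> * h i) else lam j * (h j)\<^sup>2)"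

lemma rho_pos: "0 < \<rho>" using perron by (simp add: perron_def)

lemma h_pos: "i \<in> {1..q} \<Longrightarrow> 0 < h i" using perron by (simp add: perron_def)

lemma h_zero: "i \<notin> {1..q} \<Longrightarrow> h i = 0" using perron unfolding perron_def by blast

lemma tr_zero: "j \<notin> {1..q} \<Longrightarrow> tr i j = 0"
  by (simp add: tr_def h_zero del: atLeastAtMost_iff)

lemma tr_nonneg: "0 \<le> tr i j"
proof (cases "j \<in> {1..q}")
  case True
  then show ?thesis
    using lam_pos[OF True] h_pos[OF True] rho_pos h_pos[of i] unfolding tr_def
    by (cases "i \<in> {1..q}") (auto intro!: divide_nonneg_nonneg mult_nonneg_nonneg simp: less_imp_le)
qed (simp add: tr_zero)

lemma tr_sum: "(\<Sum>j\<in>{1..q}. tr i j) = 1"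
proof (cases "i \<in> {1..q}")
  case True
  have "(\<Sum>j\<in>{1..q}. of_bool (E i j) * lam j * h j) = \<rho> * h i"
    using perron True by (simp add: perron_def)
  then have "(\<Sum>j\<in>{1..q}. of_bool (E i j) * lam j * h j / (\<rho> * h i)) = 1"
    using rho_pos h_pos[OF True] unfolding sum_divide_distrib[symmetric] by simp
  then show ?thesis using True by (simp add: tr_def)
next
  case False
  then show ?thesis using perron unfolding perron_def tr_def by auto
qed

lemma wt_tr_right:
  assumes "a \<le> b"
  shows "wt h \<rho> a (b + 1) x = wt h \<rho> a b x * tr (x b) (x (b + 1))"
proof (cases "x b \<in> {1..q}")
  case True
  have "wt h \<rho> a (b + 1) x * h (x b) = wt h \<rho> a b x * tr (x b) (x (b + 1)) * h (x b)"
    using wt_extend_right[OF assms, of h \<rho> x] True h_pos[OF True] by (simp add: tr_def)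
  then show ?thesis using h_pos[OF True] by simp
next
  case False
  then have "\<not> E (x b) (x (b + 1))" using E_dom by blast
  then have "\<not> (\<forall>k\<in>{a..<b + 1}. E (x k) (x (k + 1)))" using assms by force
  then have "wt h \<rho> a (b + 1) x = 0" by (simp add: wt_def)
  moreover have "wt h \<rho> a b x = 0" using h_zero[OF False] by (simp add: wt_def)
  ultimately show ?thesis by simp
qed

text \<open>The same kernel serves leftward steps because \<open>E\<close> is symmetric; this
  permits growing the chain in both directions from the origin.\<close>

lemma wt_tr_left:
  assumes "a \<le> b"
  shows "wt h \<rho> (a - 1) b x = wt h \<rho> a b x * tr (x a) (x (a - 1))"
proof (cases "x a \<in> {1..q}")
  case True
  have "wt h \<rho> (a - 1) b x * h (x a) = wt h \<rho> a b x * tr (x a) (x (a - 1)) * h (x a)"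
    using wt_extend_left[OF assms, of h \<rho> x] True h_pos[OF True] E_sym[of "x a"] by (simp add: tr_def)
  then show ?thesis using h_pos[OF True] by simp
next
  case False
  then have "\<not> E (x (a - 1)) (x (a - 1 + 1))" using E_dom by (simp del: atLeastAtMost_iff) blast
  then have "\<not> (\<forall>k\<in>{a - 1..<b}. E (x k) (x (k + 1)))" using assms by force
  then have "wt h \<rho> (a - 1) b x = 0" by (simp add: wt_def)
  moreover have "wt h \<rho> a b x = 0" using h_zero[OF False] by (simp add: wt_def)
  ultimately show ?thesis by simp
qed

lemma wt_window: "wt h \<rho> (- int n) (int n) x = (\<Prod>k\<in>{- int n..int n}. tr (pred_state x k) (x k))"
proof (induction n)
  case 0
  show ?case by (simp add: wt_refl pred_state_def tr_def)
next
  case (Suc n)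
  let ?n = "int n"
  have "{- int (Suc n)..int (Suc n)} = insert (?n + 1) (insert (- ?n - 1) {- ?n..?n})" by auto
  then have "(\<Prod>k\<in>{- int (Suc n)..int (Suc n)}. tr (pred_state x k) (x k)) =
      tr (pred_state x (?n + 1)) (x (?n + 1)) * (tr (pred_state x (- ?n - 1)) (x (- ?n - 1)) *
        (\<Prod>k\<in>{- ?n..?n}. tr (pred_state x k) (x k)))"
    by simp
  also have "\<dots> = tr (x ?n) (x (?n + 1)) * (tr (x (- ?n)) (x (- ?n - 1)) *
      (\<Prod>k\<in>{- ?n..?n}. tr (pred_state x k) (x k)))"
    by (simp add: pred_state_def sgn_if)
  also have "\<dots> = wt h \<rho> (- ?n - 1) (?n + 1) x"
    unfolding Suc[symmetric] by (simp add: wt_tr_left wt_tr_right)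
  also have "\<dots> = wt h \<rho> (- int (Suc n)) (int (Suc n)) x"
    by (rule arg_cong2[where f="\<lambda>a b. wt h \<rho> a b x"]) auto
  finally show ?case by (rule sym)
qed

definition step :: "nat \<Rightarrow> nat pmf" where
  "step i = embed_pmf (tr i)"

lemma pmf_step: "pmf (step i) j = tr i j"
  unfolding step_def
proof (rule pmf_embed_pmf)
  have "(\<integral>\<^sup>+ j. ennreal (tr i j) \<partial>count_space UNIV) = (\<Sum>j\<in>{1..q}. ennreal (tr i j))"
    by (rule nn_integral_count_space') (auto simp: tr_zero simp del: atLeastAtMost_iff)
  also have "\<dots> = 1" by (simp only: sum_ennreal tr_nonneg tr_sum ennreal_1)
  finally show "(\<integral>\<^sup>+ j. ennreal (tr i j) \<partial>count_space UNIV) = 1" .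
qed (rule tr_nonneg)

definition drive :: "(int \<times> nat \<Rightarrow> nat) measure" where
  "drive = PiM UNIV (\<lambda>p. measure_pmf (step (snd p)))"

sublocale drive: product_prob_space "\<lambda>p :: int \<times> nat. measure_pmf (step (snd p))" UNIV
  by (intro product_prob_spaceI measure_pmf.prob_space_axioms)

lemma prob_space_drive: "prob_space drive"
  unfolding drive_def by (rule drive.prob_space_axioms)

lemma space_drive: "space drive = UNIV"
  by (simp add: drive_def space_PiM)

lemma measurable_drive: "(\<lambda>\<omega>. \<omega> p) \<in> measurable drive (count_space UNIV)"
proof -
  have "(\<lambda>\<omega>. \<omega> p) \<in> measurable drive (measure_pmf (step (snd p)))"
    unfolding drive_def by (rule measurable_component_singleton) simp
  then show ?thesis by (simp add: measurable_cong_sets)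
qed

lemma measurable_path: "(\<lambda>\<omega>. path \<omega> k) \<in> measurable drive (count_space UNIV)"
proof -
  have "(\<lambda>\<omega>. walk s \<omega> n) \<in> measurable drive (count_space UNIV)" for s n
  proof (induction n)
    case (Suc n)
    show ?case
      unfolding walk.simps by (rule measurable_compose_countable[OF measurable_drive Suc])
  qed (simp add: measurable_drive)
  then show ?thesis by (simp add: path_def)
qed

text \<open>Different sites read different coordinates of \<open>\<omega>\<close>, so independence
  turns the window event into a product of transition probabilities.\<close>

lemma emeasure_path:
  "emeasure drive {\<omega> \<in> space drive. \<forall>k\<in>{- int n..int n}. path \<omega> k = x k} = wt h \<rho> (- int n) (int n) x"
proof -
  let ?J = "(\<lambda>k. (k, pred_state x k)) ` {- int n..int n}"
  have "{\<omega> \<in> space drive. \<forall>k\<in>{- int n..int n}. path \<omega> k = x k} =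
      {\<omega> \<in> space drive. \<forall>p\<in>?J. \<omega> p \<in> {x (fst p)}}" (is "?A = ?B")
    by (simp add: path_eq_on_iff)
  then have "emeasure drive ?A = emeasure drive ?B" by (rule arg_cong)
  also have "\<dots> = (\<Prod>p\<in>?J. emeasure (measure_pmf (step (snd p))) {x (fst p)})"
    unfolding drive_def by (rule drive.emeasure_PiM_Collect) auto
  also have "\<dots> = (\<Prod>k\<in>{- int n..int n}. ennreal (tr (pred_state x k) (x k)))"
  proof -
    have "inj_on (\<lambda>k. (k, pred_state x k)) {- int n..int n}" by (rule inj_onI) simp
    then show ?thesis
      by (subst prod.reindex) (simp_all only: comp_def fst_conv snd_conv emeasure_pmf_single pmf_step)
  qed
  also have "\<dots> = wt h \<rho> (- int n) (int n) x"
    unfolding wt_window by (rule prod_ennreal) (rule tr_nonneg)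
  finally show ?thesis .
qed

lemma AE_path_Hom: "AE \<omega> in drive. path \<omega> \<in> Hom q E"
proof -
  have "AE \<omega> in drive. \<omega> p \<in> set_pmf (step (snd p))" for p
    unfolding drive_def
    by (rule AE_PiM_component[where P="\<lambda>j. j \<in> set_pmf (step (snd p))"])
       (auto simp: AE_measure_pmf measure_pmf.prob_space_axioms)
  then have "AE \<omega> in drive. \<forall>p. \<omega> p \<in> set_pmf (step (snd p))"
    by (subst AE_all_countable) blast
  then show ?thesis
  proof (rule AE_mp, intro AE_I2 impI)
    fix \<omega> :: "int \<times> nat \<Rightarrow> nat"
    assume "\<forall>p. \<omega> p \<in> set_pmf (step (snd p))"
    \<comment> \<open>Every draw lies in the support of its law, so each transition of the path has
      nonzero \<open>tr\<close>, which forces nodes and edges.\<close>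
    then have *: "tr (pred_state (path \<omega>) k) (path \<omega> k) \<noteq> 0" for k
      using path_rec[of \<omega> k] by (metis pmf_step set_pmf_iff snd_conv)
    have V: "path \<omega> k \<in> {1..q}" for k using * tr_zero by blast
    have E: "E (path \<omega> (k - sgn k)) (path \<omega> k)" if "k \<noteq> 0" for k
      using *[of k] V[of "k - sgn k"] that by (auto simp: tr_def pred_state_def split: if_splits)
    have "E (path \<omega> k) (path \<omega> (k + 1))" for k
    proof (cases "0 \<le> k")
      case True
      then show ?thesis using E[of "k + 1"] by (simp add: sgn_if)
    next
      case False
      then show ?thesis using E[of k] E_sym[of "path \<omega> k"] by (simp add: sgn_if)
    qed
    then show "path \<omega> \<in> Hom q E" by (simp add: Hom_iff)
  qed
qed

lemma ex_window_measure:
  obtains \<mu> where "measure_on_Hom q E \<mu>"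
    "\<And>n x. measure \<mu> (cyl {- int n..int n} x) = wt h \<rho> (- int n) (int n) x"
proof -
  interpret D: prob_space drive by (rule prob_space_drive)
  \<comment> \<open>A homomorphism exists since the path almost surely is one; it replaces the path
    on the exceptional null set, so that \<open>Y\<close> takes values in \<open>Hom q E\<close>
    everywhere.\<close>
  obtain \<phi>0 where \<phi>0: "\<phi>0 \<in> Hom q E"
    using AE_path_Hom D.AE_contr by (metis (mono_tags, lifting) AE_mp AE_I2)
  define Y where "Y \<omega> = (if path \<omega> \<in> Hom q E then path \<omega> else \<phi>0)" for \<omega>
  have [measurable]: "Measurable.pred drive (\<lambda>\<omega>. path \<omega> \<in> Hom q E)"
    by (rule pred_in_Hom) (rule measurable_path)
  have Ymeas: "Y \<in> measurable drive (HomM q E)"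
  proof (rule measurable_into_HomM)
    show "Y \<in> space drive \<rightarrow> Hom q E" using \<phi>0 by (auto simp: Y_def)
    show "(\<lambda>\<omega>. Y \<omega> k) \<in> measurable drive (count_space UNIV)" for k
    proof -
      have [measurable]: "(\<lambda>\<omega>. path \<omega> k) \<in> measurable drive (count_space UNIV)" by (rule measurable_path)
      have "(\<lambda>\<omega>. Y \<omega> k) = (\<lambda>\<omega>. if path \<omega> \<in> Hom q E then path \<omega> k else \<phi>0 k)" by (auto simp: Y_def)
      then show ?thesis by simp
    qed
  qed
  define \<mu> where "\<mu> = distr drive (HomM q E) Y"
  show ?thesis
  proof (rule that)
    show "measure_on_Hom q E \<mu>"
      unfolding measure_on_Hom_def \<mu>_def using D.prob_space_distr[OF Ymeas] by simp
    fix n x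
    let ?B = "{\<omega> \<in> space drive. \<forall>k\<in>{- int n..int n}. path \<omega> k = x k}"
    have B: "?B \<in> sets drive"
    proof -
      note [measurable] = measurable_path
      show ?thesis by measurable
    qed
    have "measure \<mu> (cyl {- int n..int n} x) = measure drive (Y -` cyl {- int n..int n} x \<inter> space drive)"
      unfolding \<mu>_def by (rule measure_distr[OF Ymeas cyl_sets])
    also have "\<dots> = measure drive ?B"
    proof (rule D.finite_measure_eq_AE)
      show "AE \<omega> in drive. (\<omega> \<in> Y -` cyl {- int n..int n} x \<inter> space drive) = (\<omega> \<in> ?B)"
        using AE_path_Hom by eventually_elim (simp add: Y_def cyl_def space_drive)
    qed (use B measurable_sets[OF Ymeas cyl_sets] in auto)
    also have "\<dots> = wt h \<rho> (- int n) (int n) x"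
      unfolding measure_def emeasure_path
      unfolding wt_window by (intro enn2real_ennreal prod_nonneg) (simp add: tr_nonneg)
    finally show "measure \<mu> (cyl {- int n..int n} x) = wt h \<rho> (- int n) (int n) x" .
  qed
qed

text \<open>The construction gives only symmetric windows. An end site can be summed out on either
  side because the rows of \<open>tr\<close> sum to 1, and this reaches every window.\<close>

lemma ex_markov_measure: "\<exists>\<mu>. markov_measure q E lam \<mu> h \<rho>"
proof -
  obtain \<mu> where \<mu>: "measure_on_Hom q E \<mu>"
    and win: "\<And>n x. measure \<mu> (cyl {- int n..int n} x) = wt h \<rho> (- int n) (int n) x"
    using ex_window_measure by blast
  interpret hom_measure q E lam \<mu> by unfold_locales (rule \<mu>)
  have right: "prob (cyl {a..b} x) = wt h \<rho> a b x"
    if "a \<le> b" "\<And>x. prob (cyl {a..b + 1} x) = wt h \<rho> a (b + 1) x" for a b x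
  proof -
    have "insert (b + 1) {a..b} = {a..b + 1}" using \<open>a \<le> b\<close> by auto
    then have "prob (cyl {a..b} x) = (\<Sum>j\<in>{1..q}. wt h \<rho> a (b + 1) (x(b + 1 := j)))"
      using cyl_sum1[of "b + 1" "{a..b}" x] that(2) by simp
    also have "\<dots> = (\<Sum>j\<in>{1..q}. wt h \<rho> a b x * tr (x b) j)"
    proof (rule sum.cong[OF refl])
      fix j
      have "wt h \<rho> a b (x(b + 1 := j)) = wt h \<rho> a b x" using \<open>a \<le> b\<close> by (intro wt_cong) auto
      then show "wt h \<rho> a (b + 1) (x(b + 1 := j)) = wt h \<rho> a b x * tr (x b) j"
        using wt_tr_right[OF \<open>a \<le> b\<close>, of "x(b + 1 := j)"] by simp
    qed
    also have "\<dots> = wt h \<rho> a b x" by (simp only: sum_distrib_left[symmetric] tr_sum mult_1_right)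
    finally show ?thesis .
  qed
  have left: "prob (cyl {a..b} x) = wt h \<rho> a b x"
    if "a \<le> b" "\<And>x. prob (cyl {a - 1..b} x) = wt h \<rho> (a - 1) b x" for a b x
  proof -
    have "insert (a - 1) {a..b} = {a - 1..b}" using \<open>a \<le> b\<close> by auto
    then have "prob (cyl {a..b} x) = (\<Sum>j\<in>{1..q}. wt h \<rho> (a - 1) b (x(a - 1 := j)))"
      using cyl_sum1[of "a - 1" "{a..b}" x] that(2) by simp
    also have "\<dots> = (\<Sum>j\<in>{1..q}. wt h \<rho> a b x * tr (x a) j)"
    proof (rule sum.cong[OF refl])
      fix j
      have "wt h \<rho> a b (x(a - 1 := j)) = wt h \<rho> a b x" using \<open>a \<le> b\<close> by (intro wt_cong) auto
      then show "wt h \<rho> (a - 1) b (x(a - 1 := j)) = wt h \<rho> a b x * tr (x a) j"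
        using wt_tr_left[OF \<open>a \<le> b\<close>, of "x(a - 1 := j)"] by simp
    qed
    also have "\<dots> = wt h \<rho> a b x" by (simp only: sum_distrib_left[symmetric] tr_sum mult_1_right)
    finally show ?thesis .
  qed
  have "prob (cyl {a..b} x) = wt h \<rho> a b x" if "a \<le> b" for a b x
  proof -
    define n where "n = nat (max \<bar>a\<bar> \<bar>b\<bar>)"
    have n: "- int n \<le> a" "b \<le> int n" by (auto simp: n_def)
    \<comment> \<open>The right end is moved inward with the left end kept at
      \<open>- int n\<close>; the left end is moved afterwards.\<close>
    have R: "prob (cyl {- int n..c} x) = wt h \<rho> (- int n) c x" if "c \<le> int n" "- int n \<le> c" for c x
      using that
    proof (induction c arbitrary: x rule: int_le_induct)
      case (step c)
      show ?case by (rule right) (use step in auto)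
    qed (rule win)
    have "- int n \<le> b" using n \<open>a \<le> b\<close> by simp
    from n(1) \<open>a \<le> b\<close> show ?thesis
    proof (induction a arbitrary: x rule: int_ge_induct)
      case base
      show ?case by (rule R) (use n base in auto)
    next
      case (step c)
      show ?case by (rule left) (use step in auto)
    qed
  qed
  then have "markov_measure q E lam \<mu> h \<rho>" by unfold_locales
  then show ?thesis by blast
qed

end

text \<open>Any competitor has the window formula for some Perron pair; that pair is unique, so all
  window probabilities agree with those of the constructed measure.\<close>

theorem theorem5p3:
  fixes q :: nat and E :: "nat \<Rightarrow> nat \<Rightarrow> bool" and lam :: "nat \<Rightarrow> real"
  assumes "constraint_graph q E"
    and "graph_connected q E"
    and "has_edge E"
    and "activity q lam"
  shows "\<exists>!\<mu>. gibbs q E lam \<mu> \<and> simple q E \<mu> \<and> invariant q E \<mu>"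
proof -
  interpret hom_model q E lam by unfold_locales (use assms in auto)
  obtain h \<rho> where perron: "perron h \<rho>" using perron_exists by blast
  interpret perron_walk q E lam h \<rho> by unfold_locales (rule perron)
  obtain \<mu> where \<mu>: "markov_measure q E lam \<mu> h \<rho>" using ex_markov_measure by blast
  interpret markov_measure q E lam \<mu> h \<rho> by (rule \<mu>)
  show ?thesis
  proof (rule ex1I)
    show "gibbs q E lam \<mu> \<and> simple q E \<mu> \<and> invariant q E \<mu>"
      using gibbs simple invariant by blast
    fix \<nu> assume \<nu>: "gibbs q E lam \<nu> \<and> simple q E \<nu> \<and> invariant q E \<nu>"
    interpret N: hom_measure q E lam \<nu> by unfold_locales (use \<nu> in \<open>simp add: gibbs_def\<close>)
    obtain g \<sigma> where g: "perron g \<sigma>" "\<And>a b x. a \<le> b \<Longrightarrow> N.prob (cyl {a..b} x) = wt g \<sigma> a b x"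
      using N.reversible_gibbs_weights \<nu> by blast
    have eq: "g = h" "\<sigma> = \<rho>" using perron_unique[OF g(1) perron] by auto
    show "\<nu> = \<mu>"
    proof (rule measure_eqI_cyl[where S=UNIV and ?n0.0=0])
      fix n :: int and x assume "0 \<le> n"
      then show "emeasure \<nu> (cyl (UNIV \<inter> {-n..n}) x) = emeasure \<mu> (cyl (UNIV \<inter> {-n..n}) x)"
        using g(2)[of "-n" n x] prob_cyl[of "-n" n x]
        by (simp add: N.emeasure_eq_measure emeasure_eq_measure eq)
    qed (simp_all add: sets_sigma_on_UNIV sets_mu N.sets_mu N.finite_measure_axioms)
  qed
qed

end
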